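(* Fix a spin $s\in\{\tfrac12,1,\tfrac32,\dots\}$ and exponents $b,c$ with $\tfrac12<b<1$, $0\le c\le b$ and $c<2(1-b)$. For each $N$, let $J=sN$, let $M=M(N)>0$ be a magnetic quantum number with $M\sim N^b$, and let $d=d(N)\sim N^c$ with $2M\ge 2sd+1$. Consider the probe state $|\psi_0\rangle=\tfrac{1}{\sqrt2}(|J,M\rangle+|J,-M\rangle)$, $|\psi_\theta\rangle=e^{-i\theta\hat Q^z}|\psi_0\rangle$, $\psi_\theta=|\psi_\theta\rangle\langle\psi_\theta|$, and let $\mathcal N$ be a heralded erasure channel erasing at most $d$ qudits. Then the quantum Fisher information of the partially erased probe state satisfies $$\mathfrak F\big(\mathcal N(\psi_\theta);\,\mathcal N(\partial_\theta\psi_\theta)\big)=\Theta(N^{2b})\qquad(N\to\infty),$$ so that it scales superlinearly in $N$.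
   Context: System: $N$ spin-$s$ degrees of freedom (qudits of dimension $2s+1$) with local spin operators $\hat q_j^z,\hat q_j^\pm$ satisfying $[\hat q_j^+,\hat q_j^-]=2\hat q_j^z$, $[\hat q_j^z,\hat q_j^\pm]=\pm\hat q_j^\pm$ (spin-$s$ irreducible representation on each site), and total operators $\hat Q^z=\sum_j\hat q_j^z$, $\hat Q^\pm=\sum_j\hat q_j^\pm$. For $J=sN$ (the maximal total spin, multiplicity one, totally permutation-symmetric), $\{|J,M\rangle\}_{M=-J}^{J}$ is the orthonormal basis of the spin-$J$ irrep with $\hat Q^z|J,M\rangle=M|J,M\rangle$, $\hat Q^\pm|J,M\rangle=\sqrt{(J\mp M)(J\pm M+1)}\,|J,M\pm1\rangle$. Heralded erasure channel: $\mathcal N(\rho)=\sum_\alpha p_\alpha|\alpha\rangle\langle\alpha|_C\otimes\mathrm{Tr}_\alpha(\rho)$, where $\alpha$ ranges over sets of at most $d$ qudits, $(p_\alpha)$ is a ($\theta$-independent) probability distribution, $C$ is a classical register recording which qudits are lost, and $\mathrm{Tr}_\alpha$ is the partial trace over the qudits in $\alpha$ (in particular $\mathcal N=\mathrm{Tr}_\alpha$ for a single known set $\alpha$ is allowed). For a family of states $\rho_\theta$, the quantum Fisher information is $\mathfrak F(\rho_\theta;\partial_\theta\rho_\theta)=\mathrm{Tr}(\rho_\theta R^2)$, where $R$ is a Hermitian operator satisfying $\rho_\theta R+R\rho_\theta=2\partial_\theta\rho_\theta$. Here $\partial_\theta\psi_\theta=-i[\hat Q^z,\psi_\theta]$. $X\sim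 Y$ means $X=\Theta(Y)$ as $N\to\infty$; the constants in $\Theta(N^{2b})$ are uniform over $\theta$ and the choice of $\alpha$, $p_\alpha$. *)

theory Defs
  imports Complex_Main "HOL-Library.FuncSet" "HOL-Library.Landau_Symbols"
begin

section \<open>Linear algebra over a finite orthonormal basis\<close>

text \<open>
  The dimension of the many-body space depends on the number of sites, so a Hilbert space is
  given by the finite index set \<open>I\<close> of an orthonormal basis. Kets and operators are coefficient
  functions; only their values on \<open>I\<close> are meaningful.
\<close>

type_synonym 'i ket = "'i \<Rightarrow> complex"
type_synonym 'i oper = "'i \<Rightarrow> 'i \<Rightarrow> complex"

definition inner_on :: "'i set \<Rightarrow> 'i ket \<Rightarrow> 'i ket \<Rightarrow> complex" where
  "inner_on I u v = (\<Sum>x\<in>I. cnj (u x) * v x)"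

definition op_apply :: "'i set \<Rightarrow> 'i oper \<Rightarrow> 'i ket \<Rightarrow> 'i ket" where
  "op_apply I A v = (\<lambda>x. \<Sum>y\<in>I. A x y * v y)"

definition op_mult :: "'i set \<Rightarrow> 'i oper \<Rightarrow> 'i oper \<Rightarrow> 'i oper" where
  "op_mult I A B = (\<lambda>x y. \<Sum>z\<in>I. A x z * B z y)"

definition op_trace :: "'i set \<Rightarrow> 'i oper \<Rightarrow> complex" where
  "op_trace I A = (\<Sum>x\<in>I. A x x)"

definition op_hermitian :: "'i set \<Rightarrow> 'i oper \<Rightarrow> bool" where
  "op_hermitian I A \<longleftrightarrow> (\<forall>x\<in>I. \<forall>y\<in>I. A x y = cnj (A y x))"

definition op_commutator :: "'i set \<Rightarrow> 'i oper \<Rightarrow> 'i oper \<Rightarrow> 'i oper" where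
  "op_commutator I A B = (\<lambda>x y. op_mult I A B x y - op_mult I B A x y)"

fun op_power :: "'i set \<Rightarrow> 'i oper \<Rightarrow> nat \<Rightarrow> 'i oper" where
  "op_power I A 0 = (\<lambda>x y. if x = y then 1 else 0)"
| "op_power I A (Suc k) = op_mult I A (op_power I A k)"

definition op_exp :: "'i set \<Rightarrow> 'i oper \<Rightarrow> 'i oper" where
  "op_exp I A = (\<lambda>x y. \<Sum>k. op_power I A k x y / fact k)"

definition ket_bra :: "'i ket \<Rightarrow> 'i oper" where
  "ket_bra v = (\<lambda>x y. v x * cnj (v y))"


section \<open>Quantum Fisher information\<close>

definition is_SLD :: "'i set \<Rightarrow> 'i oper \<Rightarrow> 'i oper \<Rightarrow> 'i oper \<Rightarrow> bool" where
  "is_SLD I \<rho> d\<rho> R \<longleftrightarrow> op_hermitian I R \<and>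
     (\<forall>x\<in>I. \<forall>y\<in>I. op_mult I \<rho> R x y + op_mult I R \<rho> x y = 2 * d\<rho> x y)"

text \<open>
  Defined when a symmetric logarithmic derivative exists. Its value does not depend on the
  choice of that operator, see \<open>qfi_eq\<close> below. The trace is real for Hermitian \<open>\<rho>\<close>.
\<close>

definition qfi :: "'i set \<Rightarrow> 'i oper \<Rightarrow> 'i oper \<Rightarrow> real" where
  "qfi I \<rho> d\<rho> = (THE F. \<exists>R. is_SLD I \<rho> d\<rho> R \<and>
                      F = Re (op_trace I (op_mult I \<rho> (op_mult I R R))))"


section \<open>Spins\<close>

text \<open>
  Throughout, \<open>n = 2 * s\<close>. The level \<open>k \<in> {..n}\<close> of one site is the spin-\<open>s\<close> state with magnetic
  quantum number \<open>m = k - s\<close>.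
\<close>

definition spin_z :: "nat \<Rightarrow> nat oper" where
  "spin_z n k l = (if k = l then of_real (real l - real n / 2) else 0)"

definition spin_plus :: "nat \<Rightarrow> nat oper" where
  "spin_plus n k l = (let s = real n / 2; m = real l - s in
     if k = l + 1 then of_real (sqrt ((s - m) * (s + m + 1))) else 0)"

definition spin_minus :: "nat \<Rightarrow> nat oper" where
  "spin_minus n k l = (let s = real n / 2; m = real l - s in
     if k + 1 = l then of_real (sqrt ((s + m) * (s - m + 1))) else 0)"

definition cfg :: "nat \<Rightarrow> nat set \<Rightarrow> (nat \<Rightarrow> nat) set" where
  "cfg n S = (S \<rightarrow>\<^sub>E {..n})"

definition site_op :: "nat set \<Rightarrow> nat \<Rightarrow> nat oper \<Rightarrow> (nat \<Rightarrow> nat) oper" where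
  "site_op S j q x y = (if \<forall>i\<in>S - {j}. x i = y i then q (x j) (y j) else 0)"

definition total_op :: "nat \<Rightarrow> nat oper \<Rightarrow> (nat \<Rightarrow> nat) oper" where
  "total_op N q x y = (\<Sum>j<N. site_op {..<N} j q x y)"

abbreviation "Qz n N \<equiv> total_op N (spin_z n)"
abbreviation "Qplus n N \<equiv> total_op N (spin_plus n)"
abbreviation "Qminus n N \<equiv> total_op N (spin_minus n)"

definition mag_numbers :: "real \<Rightarrow> real set" where
  "mag_numbers J = {M. M \<le> J \<and> (\<exists>k::nat. M = real k - J)}"

text \<open>
  \<open>ket M\<close> is \<open>|J,M\<rangle>\<close> for \<open>J = s * N\<close>. The relations determine the family up to one global phase.
  At the ends of the ladder the coefficient vanishes, so \<open>ket (J + 1)\<close> and \<open>ket (- J - 1)\<close> are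
  irrelevant.
\<close>

definition top_multiplet :: "nat \<Rightarrow> nat \<Rightarrow> (real \<Rightarrow> (nat \<Rightarrow> nat) ket) \<Rightarrow> bool" where
  "top_multiplet n N ket \<longleftrightarrow> (let J = real n / 2 * real N; I = cfg n {..<N} in
     (\<forall>M\<in>mag_numbers J. \<forall>M'\<in>mag_numbers J.
        inner_on I (ket M) (ket M') = (if M = M' then 1 else 0)) \<and>
     (\<forall>M\<in>mag_numbers J. \<forall>x\<in>I.
        op_apply I (Qz n N) (ket M) x = of_real M * ket M x \<and>
        op_apply I (Qplus n N) (ket M) x
          = of_real (sqrt ((J - M) * (J + M + 1))) * ket (M + 1) x \<and>
        op_apply I (Qminus n N) (ket M) x
          = of_real (sqrt ((J + M) * (J - M + 1))) * ket (M - 1) x))"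


section \<open>Heralded erasure\<close>

definition partial_trace :: "nat \<Rightarrow> nat set \<Rightarrow> (nat \<Rightarrow> nat) oper \<Rightarrow> (nat \<Rightarrow> nat) oper" where
  "partial_trace n \<alpha> \<rho> x y = (\<Sum>z\<in>cfg n \<alpha>. \<rho> (override_on x z \<alpha>) (override_on y z \<alpha>))"

definition erasure_sets :: "nat \<Rightarrow> nat \<Rightarrow> nat set set" where
  "erasure_sets N d = {\<alpha>. \<alpha> \<subseteq> {..<N} \<and> card \<alpha> \<le> d}"

definition erasure_dist :: "nat \<Rightarrow> nat \<Rightarrow> (nat set \<Rightarrow> real) \<Rightarrow> bool" where
  "erasure_dist N d p \<longleftrightarrow> (\<forall>\<alpha>\<in>erasure_sets N d. 0 \<le> p \<alpha>) \<and> (\<Sum>\<alpha>\<in>erasure_sets N d. p \<alpha>) = 1"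

text \<open>
  The basis vector \<open>(\<alpha>, x)\<close> is \<open>|\<alpha>\<rangle>\<^sub>C \<otimes> |x\<rangle>\<close> with \<open>x\<close> a configuration of the surviving sites.
\<close>

definition erased_space :: "nat \<Rightarrow> nat \<Rightarrow> nat \<Rightarrow> (nat set \<times> (nat \<Rightarrow> nat)) set" where
  "erased_space n N d = (SIGMA \<alpha>:erasure_sets N d. cfg n ({..<N} - \<alpha>))"

definition erase ::
  "nat \<Rightarrow> (nat set \<Rightarrow> real) \<Rightarrow> (nat \<Rightarrow> nat) oper \<Rightarrow> (nat set \<times> (nat \<Rightarrow> nat)) oper" where
  "erase n p \<rho> = (\<lambda>(\<alpha>, x) (\<beta>, y).
     if \<alpha> = \<beta> then of_real (p \<alpha>) * partial_trace n \<alpha> \<rho> x y else 0)"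


section \<open>The probe state\<close>

definition probe_ket :: "(real \<Rightarrow> 'i ket) \<Rightarrow> real \<Rightarrow> 'i ket" where
  "probe_ket ket M x = (ket M x + ket (- M) x) / of_real (sqrt 2)"

definition probe_state ::
  "nat \<Rightarrow> nat \<Rightarrow> (real \<Rightarrow> (nat \<Rightarrow> nat) ket) \<Rightarrow> real \<Rightarrow> real \<Rightarrow> (nat \<Rightarrow> nat) oper" where
  "probe_state n N ket M \<theta> = (let I = cfg n {..<N} in
     ket_bra (op_apply I (op_exp I (\<lambda>x y. - \<i> * of_real \<theta> * Qz n N x y)) (probe_ket ket M)))"

definition probe_deriv ::
  "nat \<Rightarrow> nat \<Rightarrow> (real \<Rightarrow> (nat \<Rightarrow> nat) ket) \<Rightarrow> real \<Rightarrow> real \<Rightarrow> (nat \<Rightarrow> nat) oper" where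
  "probe_deriv n N ket M \<theta> = (\<lambda>x y.
     - \<i> * op_commutator (cfg n {..<N}) (Qz n N) (probe_state n N ket M \<theta>) x y)"


section \<open>Well-definedness\<close>

lemma op_mult_assoc: "op_mult I (op_mult I A B) C x y = op_mult I A (op_mult I B C) x y"
proof -
  have "op_mult I (op_mult I A B) C x y = (\<Sum>z\<in>I. \<Sum>w\<in>I. A x w * B w z * C z y)"
    by (simp add: op_mult_def sum_distrib_right)
  also have "\<dots> = (\<Sum>w\<in>I. \<Sum>z\<in>I. A x w * B w z * C z y)" by (rule sum.swap)
  also have "\<dots> = op_mult I A (op_mult I B C) x y"
    by (simp add: op_mult_def sum_distrib_left mult.assoc)
  finally show ?thesis .
qed

lemma op_trace_cyclic: "op_trace I (op_mult I A B) = op_trace I (op_mult I B A)"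
proof -
  have "op_trace I (op_mult I A B) = (\<Sum>x\<in>I. \<Sum>z\<in>I. A x z * B z x)"
    by (simp add: op_trace_def op_mult_def)
  also have "\<dots> = (\<Sum>z\<in>I. \<Sum>x\<in>I. A x z * B z x)" by (rule sum.swap)
  also have "\<dots> = op_trace I (op_mult I B A)"
    by (simp add: op_trace_def op_mult_def mult.commute)
  finally show ?thesis .
qed

lemma SLD_trace_pairing:
  assumes "is_SLD I \<rho> d\<rho> R"
  shows "2 * op_trace I (op_mult I d\<rho> X)
       = op_trace I (op_mult I \<rho> (op_mult I R X)) + op_trace I (op_mult I \<rho> (op_mult I X R))"
proof -
  have "2 * op_trace I (op_mult I d\<rho> X) = (\<Sum>x\<in>I. \<Sum>z\<in>I. (2 * d\<rho> x z) * X z x)"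
    by (simp add: op_trace_def op_mult_def sum_distrib_left mult.assoc)
  also have "\<dots> = (\<Sum>x\<in>I. \<Sum>z\<in>I. (op_mult I \<rho> R x z + op_mult I R \<rho> x z) * X z x)"
    using assms by (intro sum.cong refl) (simp add: is_SLD_def)
  also have "\<dots> = op_trace I (op_mult I (op_mult I \<rho> R) X) + op_trace I (op_mult I (op_mult I R \<rho>) X)"
    unfolding op_trace_def op_mult_def[of I "op_mult I \<rho> R" X] op_mult_def[of I "op_mult I R \<rho>" X]
    by (simp add: distrib_right sum.distrib)
  also have "op_trace I (op_mult I (op_mult I \<rho> R) X) = op_trace I (op_mult I \<rho> (op_mult I R X))"
    by (simp add: op_trace_def op_mult_assoc)
  also have "op_trace I (op_mult I (op_mult I R \<rho>) X) = op_trace I (op_mult I R (op_mult I \<rho> X))"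
    by (simp add: op_trace_def op_mult_assoc)
  also have "\<dots> = op_trace I (op_mult I (op_mult I \<rho> X) R)" by (rule op_trace_cyclic)
  also have "\<dots> = op_trace I (op_mult I \<rho> (op_mult I X R))"
    by (simp add: op_trace_def op_mult_assoc)
  finally show ?thesis .
qed

lemma qfi_eq:
  assumes "is_SLD I \<rho> d\<rho> R"
  shows "qfi I \<rho> d\<rho> = Re (op_trace I (op_mult I \<rho> (op_mult I R R)))"
  unfolding qfi_def
proof (rule the_equality)
  show "\<exists>R'. is_SLD I \<rho> d\<rho> R' \<and> Re (op_trace I (op_mult I \<rho> (op_mult I R R)))
          = Re (op_trace I (op_mult I \<rho> (op_mult I R' R')))"
    using assms by blast
next
  fix F
  assume "\<exists>R'. is_SLD I \<rho> d\<rho> R' \<and> F = Re (op_trace I (op_mult I \<rho> (op_mult I R' R')))"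
  then obtain R' where R': "is_SLD I \<rho> d\<rho> R'"
    and F: "F = Re (op_trace I (op_mult I \<rho> (op_mult I R' R')))"
    by blast
  define T where "T A B = op_trace I (op_mult I \<rho> (op_mult I A B))" for A B
  note 1 = SLD_trace_pairing[OF assms, folded T_def]
  note 2 = SLD_trace_pairing[OF R', folded T_def]
  have "T R' R' + T R' R' = T R R + T R R"
    using 1[of R] 1[of R'] 2[of R] 2[of R'] by (simp only: add.commute)
  then have "T R' R' = T R R" by simp
  then show "F = Re (op_trace I (op_mult I \<rho> (op_mult I R R)))"
    by (simp add: F T_def)
qed


section \<open>Existence of the multiplet: Dicke states\<close>

lemma mag_numbers_D:
  assumes "real n / 2 * real N = J" "M \<in> mag_numbers J"
  shows "\<exists>k\<le>n*N. M = real k - J"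
proof -
  obtain k :: nat where k: "M = real k - J" "M \<le> J"
    using assms(2) unfolding mag_numbers_def by blast
  have "real k \<le> real (n * N)" using k assms(1) by simp
  then show ?thesis using k by (auto simp only: of_nat_le_iff)
qed

lemma finite_cfg: "finite S \<Longrightarrow> finite (cfg n S)"
  by (simp add: cfg_def finite_PiE)

lemma sum_site_op:
  assumes "x \<in> cfg n S" "j \<in> S" "finite S"
  shows "(\<Sum>y\<in>cfg n S. site_op S j q x y * v y) = (\<Sum>l\<le>n. q (x j) l * v (x(j := l)))"
proof -
  have sub: "(\<lambda>l. x(j := l)) ` {..n} \<subseteq> cfg n S"
    using assms by (auto simp: cfg_def PiE_iff extensional_def)
  have inj: "inj_on (\<lambda>l. x(j := l)) {..n}"
    by (auto simp: inj_on_def fun_eq_iff split: if_splits)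
  have "(\<Sum>y\<in>cfg n S. site_op S j q x y * v y)
      = (\<Sum>y\<in>(\<lambda>l. x(j := l)) ` {..n}. site_op S j q x y * v y)"
  proof (rule sum.mono_neutral_right[OF finite_cfg[OF assms(3)] sub], intro ballI)
    fix y assume y: "y \<in> cfg n S - (\<lambda>l. x(j := l)) ` {..n}"
    have "\<not> (\<forall>i\<in>S - {j}. x i = y i)"
    proof
      assume a: "\<forall>i\<in>S - {j}. x i = y i"
      have "y i = (x(j := y j)) i" for i
        using a y assms by (cases "i \<in> S") (auto simp: cfg_def PiE_iff extensional_def)
      then have "y = x(j := y j)" by (rule ext)
      moreover have "y j \<le> n" using y assms by (auto simp: cfg_def PiE_iff)
      ultimately show False using y by auto
    qed
    then show "site_op S j q x y * v y = 0" by (auto simp: site_op_def)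
  qed
  also have "\<dots> = (\<Sum>l\<le>n. q (x j) l * v (x(j := l)))"
    by (subst sum.reindex[OF inj]) (auto simp: site_op_def intro!: sum.cong)
  finally show ?thesis .
qed

lemma total_op_apply:
  assumes "x \<in> cfg n {..<N}"
  shows "op_apply (cfg n {..<N}) (total_op N q) v x = (\<Sum>j<N. \<Sum>l\<le>n. q (x j) l * v (x(j := l)))"
proof -
  have "op_apply (cfg n {..<N}) (total_op N q) v x
      = (\<Sum>y\<in>cfg n {..<N}. \<Sum>j<N. site_op {..<N} j q x y * v y)"
    by (simp add: op_apply_def total_op_def sum_distrib_right)
  also have "\<dots> = (\<Sum>j<N. \<Sum>y\<in>cfg n {..<N}. site_op {..<N} j q x y * v y)" by (rule sum.swap)
  also have "\<dots> = (\<Sum>j<N. \<Sum>l\<le>n. q (x j) l * v (x(j := l)))"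
    using assms by (intro sum.cong refl sum_site_op) auto
  finally show ?thesis .
qed

lemma binomial_shift: "(n choose Suc l) * Suc l = (n choose l) * (n - l)"
  by (metis binomial_absorb_comp binomial_absorption mult.commute)

lemma sqrt_shift:
  assumes "l < n"
  shows "sqrt (real (n choose l)) * sqrt (real (n - l) * real (Suc l)) = sqrt (real (n choose Suc l)) * real (Suc l)"
    and "sqrt (real (n choose Suc l)) * sqrt (real (n - l) * real (Suc l)) = sqrt (real (n choose l)) * real (n - l)"
proof -
  have e: "real (n choose Suc l) * real (Suc l) = real (n choose l) * real (n - l)"
    using binomial_shift[of n l] by (metis of_nat_mult)
  have "sqrt (real (n choose l)) * sqrt (real (n - l) * real (Suc l)) = sqrt ((real (n choose l) * real (n - l)) * real (Suc l))"
    by (simp only: real_sqrt_mult mult.assoc)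
  also have "\<dots> = sqrt (real (n choose Suc l)) * sqrt (real (Suc l) * real (Suc l))"
    by (simp only: e[symmetric] real_sqrt_mult mult.assoc)
  finally show "sqrt (real (n choose l)) * sqrt (real (n - l) * real (Suc l)) = sqrt (real (n choose Suc l)) * real (Suc l)"
    by simp
  have "sqrt (real (n choose Suc l)) * sqrt (real (n - l) * real (Suc l)) = sqrt ((real (n choose Suc l) * real (Suc l)) * real (n - l))"
    by (simp only: real_sqrt_mult mult_ac)
  also have "\<dots> = sqrt (real (n choose l)) * sqrt (real (n - l) * real (n - l))"
    unfolding e real_sqrt_mult by (simp only: mult.assoc)
  finally show "sqrt (real (n choose Suc l)) * sqrt (real (n - l) * real (Suc l)) = sqrt (real (n choose l)) * real (n - l)"
    by simp
qed

lemma spin_plus_Suc: "l < n \<Longrightarrow> spin_plus n (Suc l) l = of_real (sqrt (real (n - l) * real (Suc l)))"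
  by (simp add: spin_plus_def Let_def of_nat_diff field_simps)

lemma spin_minus_Suc: "l < n \<Longrightarrow> spin_minus n l (Suc l) = of_real (sqrt (real (n - l) * real (Suc l)))"
  by (simp add: spin_minus_def Let_def of_nat_diff field_simps)

definition dicke_weight :: "nat \<Rightarrow> nat \<Rightarrow> (nat \<Rightarrow> nat) \<Rightarrow> real" where
  "dicke_weight n N x = (\<Prod>i<N. sqrt (real (n choose x i)))"

definition dicke :: "nat \<Rightarrow> nat \<Rightarrow> real \<Rightarrow> (nat \<Rightarrow> nat) ket" where
  "dicke n N M x = (if real (sum x {..<N}) = M + real n / 2 * real N
     then of_real (dicke_weight n N x / sqrt (real (n * N choose sum x {..<N}))) else 0)"

lemma sum_upd: "j < N \<Longrightarrow> sum (x(j := l)) {..<N} + x j = sum x {..<(N::nat)} + (l::nat)"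
  by (simp add: sum.remove[of "{..<N}" j])

lemma dicke_weight_upd: "j < N \<Longrightarrow> dicke_weight n N (x(j := l)) * sqrt (real (n choose x j)) = dicke_weight n N x * sqrt (real (n choose l))"
  unfolding dicke_weight_def by (simp add: prod.remove[of "{..<N}" j])

lemma dicke_weight_plus:
  assumes "j < N" "x j = Suc l" "l < n"
  shows "sqrt (real (n - l) * real (Suc l)) * dicke_weight n N (x(j := l)) = real (x j) * dicke_weight n N x"
proof -
  have p: "sqrt (real (n choose Suc l)) > 0" using assms(3) by simp
  have "sqrt (real (n choose Suc l)) * (sqrt (real (n - l) * real (Suc l)) * dicke_weight n N (x(j := l)))
      = (dicke_weight n N (x(j := l)) * sqrt (real (n choose x j))) * sqrt (real (n - l) * real (Suc l))"
    by (simp add: assms(2))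
  also have "\<dots> = dicke_weight n N x * (sqrt (real (n choose l)) * sqrt (real (n - l) * real (Suc l)))"
    by (simp only: dicke_weight_upd[OF assms(1)] mult.assoc)
  also have "\<dots> = dicke_weight n N x * (sqrt (real (n choose Suc l)) * real (Suc l))"
    by (simp only: sqrt_shift(1)[OF assms(3)])
  also have "\<dots> = sqrt (real (n choose Suc l)) * (real (x j) * dicke_weight n N x)"
    by (simp add: assms(2))
  finally show ?thesis using p by (subst (asm) mult_cancel_left) auto
qed

lemma dicke_weight_minus:
  assumes "j < N" "x j = l" "l < n"
  shows "sqrt (real (n - l) * real (Suc l)) * dicke_weight n N (x(j := Suc l)) = real (n - x j) * dicke_weight n N x"
proof -
  have p: "sqrt (real (n choose l)) > 0" using assms(3) by simp
  have "sqrt (real (n choose l)) * (sqrt (real (n - l) * real (Suc l)) * dicke_weight n N (x(j := Suc l)))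
      = (dicke_weight n N (x(j := Suc l)) * sqrt (real (n choose x j))) * sqrt (real (n - l) * real (Suc l))"
    by (simp add: assms(2))
  also have "\<dots> = dicke_weight n N x * (sqrt (real (n choose Suc l)) * sqrt (real (n - l) * real (Suc l)))"
    by (simp only: dicke_weight_upd[OF assms(1)] mult.assoc)
  also have "\<dots> = dicke_weight n N x * (sqrt (real (n choose l)) * real (n - l))"
    by (simp only: sqrt_shift(2)[OF assms(3)])
  also have "\<dots> = sqrt (real (n choose l)) * (real (n - x j) * dicke_weight n N x)"
    by (simp add: assms(2))
  finally show ?thesis using p by (subst (asm) mult_cancel_left) auto
qed

lemma sum_cfg_le: "x \<in> cfg n {..<N} \<Longrightarrow> sum x {..<N} \<le> n * N"
  using sum_bounded_above[of "{..<N}" x n] by (auto simp: cfg_def PiE_iff mult.commute)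

lemma vandermonde_cfg:
  "finite S \<Longrightarrow> (\<Sum>x | x \<in> cfg n S \<and> sum x S = k. \<Prod>i\<in>S. n choose x i) = (n * card S choose k)"
proof (induction S arbitrary: k rule: finite_induct)
  case empty
  have "{x. x \<in> cfg n {} \<and> sum x {} = k} = (if k = 0 then {\<lambda>_. undefined} else {})"
    by (auto simp: cfg_def)
  then show ?case by (cases k) auto
next
  case (insert a S)
  let ?A = "\<lambda>l. {x. x \<in> cfg n S \<and> sum x S = k - l}"
  have "(n * card (insert a S) choose k) = (n + n * card S choose k)"
    using insert by simp
  also have "\<dots> = (\<Sum>l\<le>k. (n choose l) * (n * card S choose (k - l)))"
    by (rule vandermonde[symmetric])
  also have "\<dots> = (\<Sum>l\<in>{l. l \<le> k \<and> l \<le> n}. (n choose l) * (n * card S choose (k - l)))"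
    by (rule sum.mono_neutral_right) (auto simp: binomial_eq_0)
  also have "\<dots> = (\<Sum>l\<in>{l. l \<le> k \<and> l \<le> n}. \<Sum>x\<in>?A l. (n choose l) * (\<Prod>i\<in>S. n choose x i))"
    by (simp add: insert.IH[symmetric] sum_distrib_left)
  also have "\<dots> = (\<Sum>(l, x)\<in>(SIGMA l:{l. l \<le> k \<and> l \<le> n}. ?A l). (n choose l) * (\<Prod>i\<in>S. n choose x i))"
    by (rule sum.Sigma) (use finite_cfg[OF insert(1)] in auto)
  also have "\<dots> = (\<Sum>x | x \<in> cfg n (insert a S) \<and> sum x (insert a S) = k. \<Prod>i\<in>insert a S. n choose x i)"
  proof (rule sum.reindex_bij_witness[where
        i = "\<lambda>x. (x a, x(a := undefined))" and j = "\<lambda>(l, x). x(a := l)"])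
    have s: "sum (x(a := t)) S = sum x S" for x t
      using insert(2) by (intro sum.cong) auto
    have p: "(\<Prod>i\<in>S. n choose (x(a := t)) i) = (\<Prod>i\<in>S. n choose x i)" for x t
      using insert(2) by (intro prod.cong) auto
    {
      fix p assume h: "p \<in> (SIGMA l:{l. l \<le> k \<and> l \<le> n}. ?A l)"
      obtain l x where [simp]: "p = (l, x)" by (cases p)
      from h have h: "l \<le> k" "l \<le> n" "x \<in> cfg n S" "sum x S = k - l" by auto
      have xa: "x a = undefined" using h(3) insert(2) by (auto simp: cfg_def PiE_iff extensional_def)
      show "(case (case p of (l, x) \<Rightarrow> x(a := l)) of x \<Rightarrow> (x a, x(a := undefined))) = p"
        using xa by (auto simp: fun_eq_iff)
      show "(case p of (l, x) \<Rightarrow> x(a := l)) \<in> {x. x \<in> cfg n (insert a S) \<and> sum x (insert a S) = k}"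
        using h insert(1,2) s[of x l] by (auto simp: cfg_def PiE_iff extensional_def)
      show "(\<Prod>i\<in>insert a S. n choose (case p of (l, x) \<Rightarrow> x(a := l)) i) = (case p of (l, x) \<Rightarrow> (n choose l) * (\<Prod>i\<in>S. n choose x i))"
        using insert(1,2) p[of x l] by simp
    }
    fix x assume h: "x \<in> {x. x \<in> cfg n (insert a S) \<and> sum x (insert a S) = k}"
    show "(case (x a, x(a := undefined)) of (l, x) \<Rightarrow> x(a := l)) = x" by simp
    show "(x a, x(a := undefined)) \<in> (SIGMA l:{l. l \<le> k \<and> l \<le> n}. ?A l)"
      using h insert(1,2) s[of x undefined] by (auto simp: cfg_def PiE_iff extensional_def)
  qed
  finally show ?case by simp
qed

lemma frac_shift: "a * S = b * X \<Longrightarrow> a > 0 \<Longrightarrow> b > 0 \<Longrightarrow> X / a = S / (b::real)"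
  by (simp add: frac_eq_eq mult.commute)

lemma sum_if_collect: "(\<Sum>j<N. if P then complex_of_real (real (f j) * w / c) else 0)
    = (if P then of_real (real (\<Sum>j<(N::nat). f j) * w / c) else 0)"
  by (cases P) (simp_all add: sum_divide_distrib sum_distrib_right)

lemma dicke_top_multiplet: "top_multiplet n N (dicke n N)"
proof -
  define J where "J = real n / 2 * real N"
  define I where "I = cfg n {..<N}"
  have J2: "2 * J = real (n * N)" by (simp add: J_def)
  have inner: "inner_on I (dicke n N M) (dicke n N M') = (if M = M' then 1 else 0)"
    if M: "M \<in> mag_numbers J" for M M'
  proof (cases "M = M'")
    case False
    then show ?thesis by (auto simp: inner_on_def dicke_def intro!: sum.neutral)
  next
    case True
    obtain k where k: "k \<le> n * N" "M = real k - J" using mag_numbers_D[OF J_def[symmetric] M] by blast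
    have fin: "finite I" by (simp add: I_def finite_cfg)
    have "inner_on I (dicke n N M) (dicke n N M)
        = (\<Sum>x\<in>I. if sum x {..<N} = k then of_real ((\<Prod>i<N. real (n choose x i)) / real (n * N choose k)) else 0)"
      unfolding inner_on_def
    proof (intro sum.cong refl)
      fix x
      have w: "dicke_weight n N x * dicke_weight n N x = (\<Prod>i<N. real (n choose x i))"
        by (simp add: dicke_weight_def prod.distrib[symmetric])
      have r: "(dicke_weight n N x / sqrt (real (n * N choose k))) * (dicke_weight n N x / sqrt (real (n * N choose k)))
          = (\<Prod>i<N. real (n choose x i)) / real (n * N choose k)"
        by (simp only: times_divide_times_eq w real_sqrt_mult_self abs_of_nat)
      have c: "(real (sum x {..<N}) = M + J) = (sum x {..<N} = k)"
        unfolding k(2) by (simp del: of_nat_sum)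
      have "cnj (dicke n N M x) * dicke n N M x = of_real (if sum x {..<N} = k
         then (dicke_weight n N x / sqrt (real (n * N choose k))) * (dicke_weight n N x / sqrt (real (n * N choose k))) else 0)"
        unfolding dicke_def J_def[symmetric] c
        by (cases "sum x {..<N} = k")
          (simp_all only: simp_thms if_True if_False complex_cnj_complex_of_real of_real_mult of_real_0 complex_cnj_zero mult_zero_left)
      also have "\<dots> = (if sum x {..<N} = k then of_real ((\<Prod>i<N. real (n choose x i)) / real (n * N choose k)) else 0)"
        unfolding r by simp
      finally show "cnj (dicke n N M x) * dicke n N M x = \<dots>" .
    qed
    also have "\<dots> = (\<Sum>x | x \<in> I \<and> sum x {..<N} = k. of_real ((\<Prod>i<N. real (n choose x i)) / real (n * N choose k)))"
      by (rule sum.inter_filter[OF fin, symmetric])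
    also have "\<dots> = of_real (real (\<Sum>x | x \<in> I \<and> sum x {..<N} = k. \<Prod>i<N. n choose x i) / real (n * N choose k))"
      by (simp add: sum_divide_distrib)
    also have "\<dots> = 1"
      using k(1) vandermonde_cfg[of "{..<N}" n k] by (simp add: I_def)
    finally show ?thesis using True by simp
  qed
  have qz: "op_apply I (Qz n N) (dicke n N M) x = of_real M * dicke n N M x"
    if x: "x \<in> I" for M x
  proof -
    have "op_apply I (Qz n N) (dicke n N M) x
        = (\<Sum>j<N. of_real (real (x j) - real n / 2) * dicke n N M x)"
      unfolding I_def total_op_apply[OF x[unfolded I_def]]
    proof (intro sum.cong refl)
      fix j assume "j \<in> {..<N}"
      then have xj: "x j \<le> n" using x by (auto simp: I_def cfg_def PiE_iff)
      have "(\<Sum>l\<le>n. spin_z n (x j) l * dicke n N M (x(j := l)))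
          = (\<Sum>l\<le>n. if l = x j then of_real (real (x j) - real n / 2) * dicke n N M x else 0)"
        by (intro sum.cong) (auto simp: spin_z_def)
      then show "(\<Sum>l\<le>n. spin_z n (x j) l * dicke n N M (x(j := l)))
          = of_real (real (x j) - real n / 2) * dicke n N M x" using xj by simp
    qed
    also have "\<dots> = of_real (real (sum x {..<N}) - J) * dicke n N M x"
      by (simp add: sum_distrib_right[symmetric] sum_subtractf J_def)
    also have "\<dots> = of_real M * dicke n N M x"
      by (cases "real (sum x {..<N}) = M + J")
        (simp_all only: dicke_def J_def[symmetric] if_False mult_zero_right add_diff_cancel_right')
    finally show ?thesis .
  qed
  have qp: "op_apply I (Qplus n N) (dicke n N M) x
      = of_real (sqrt ((J - M) * (J + M + 1))) * dicke n N (M + 1) x"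
    if x: "x \<in> I" for M x
  proof -
    let ?K = "sum x {..<N}" and ?C = "\<lambda>k. sqrt (real (n * N choose k))"
    have "op_apply I (Qplus n N) (dicke n N M) x
        = (\<Sum>j<N. if real ?K = M + 1 + J then of_real (real (x j) * dicke_weight n N x / ?C (?K - 1)) else 0)"
      unfolding I_def total_op_apply[OF x[unfolded I_def]]
    proof (intro sum.cong refl)
      fix j assume "j \<in> {..<N}"
      then have xj: "x j \<le> n" and j: "j < N" using x by (auto simp: I_def cfg_def PiE_iff)
      show "(\<Sum>l\<le>n. spin_plus n (x j) l * dicke n N M (x(j := l)))
          = (if real ?K = M + 1 + J then of_real (real (x j) * dicke_weight n N x / ?C (?K - 1)) else 0)"
      proof (cases "x j")
        case 0
        then show ?thesis by (auto simp: spin_plus_def intro!: sum.neutral)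
      next
        case (Suc m)
        then have m: "m < n" using xj by simp
        have K: "?K = Suc (sum (x(j := m)) {..<N})" using sum_upd[OF j, of x m] Suc by simp
        have "(\<Sum>l\<le>n. spin_plus n (x j) l * dicke n N M (x(j := l)))
            = (\<Sum>l\<le>n. if l = m then spin_plus n (Suc m) m * dicke n N M (x(j := m)) else 0)"
          using Suc by (intro sum.cong) (auto simp: spin_plus_def)
        also have "\<dots> = spin_plus n (Suc m) m * dicke n N M (x(j := m))" using m by simp
        also have "\<dots> = (if real ?K = M + 1 + J
            then of_real (sqrt (real (n - m) * real (Suc m)) * dicke_weight n N (x(j := m)) / ?C (?K - 1)) else 0)"
          unfolding spin_plus_Suc[OF m] dicke_def J_def[symmetric] K by auto
        also have "\<dots> = (if real ?K = M + 1 + J then of_real (real (x j) * dicke_weight n N x / ?C (?K - 1)) else 0)"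
          by (simp only: dicke_weight_plus[where x = x, OF j Suc m])
        finally show ?thesis .
      qed
    qed
    also have "\<dots> = (if real ?K = M + 1 + J then of_real (real ?K * dicke_weight n N x / ?C (?K - 1)) else 0)"
      by (rule sum_if_collect)
    also have "\<dots> = of_real (sqrt ((J - M) * (J + M + 1))) * dicke n N (M + 1) x"
    proof (cases "real ?K = M + 1 + J")
      case True
      have Kle: "?K \<le> n * N" using sum_cfg_le x I_def by auto
      have JM: "J + M + 1 = real ?K" "J - M = real (n * N) - real ?K + 1" using True J2 by auto
      have "real ?K * dicke_weight n N x / ?C (?K - 1) = sqrt ((J - M) * (J + M + 1)) * (dicke_weight n N x / ?C ?K)"
      proof (cases "?K")
        case 0
        then show ?thesis using JM by simp
      next
        case (Suc l)
        have l: "l < n * N" using Kle Suc by simp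
        have e: "(J - M) * (J + M + 1) = real (n * N - l) * real (Suc l)"
          using JM Suc l by (simp add: of_nat_diff)
        have p: "?C l > 0" "?C (Suc l) > 0" using l by auto
        have "?C l * sqrt (real (n * N - l) * real (Suc l)) = ?C (Suc l) * real (Suc l)"
          by (rule sqrt_shift(1)[OF l])
        then have "real (Suc l) / ?C l = sqrt (real (n * N - l) * real (Suc l)) / ?C (Suc l)"
          using p by (intro frac_shift)
        then have "real (Suc l) / ?C l * dicke_weight n N x = sqrt (real (n * N - l) * real (Suc l)) / ?C (Suc l) * dicke_weight n N x"
          by (rule arg_cong)
        then show ?thesis unfolding e Suc by simp
      qed
      then show ?thesis using True
        by (simp only: dicke_def J_def[symmetric] simp_thms if_True of_real_mult[symmetric])
    next
      case False
      then show ?thesis by (simp add: dicke_def J_def)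
    qed
    finally show ?thesis .
  qed
  have qm: "op_apply I (Qminus n N) (dicke n N M) x
      = of_real (sqrt ((J + M) * (J - M + 1))) * dicke n N (M - 1) x"
    if x: "x \<in> I" for M x
  proof -
    let ?K = "sum x {..<N}" and ?C = "\<lambda>k. sqrt (real (n * N choose k))"
    have xle: "x j \<le> n" if "j < N" for j using x that by (auto simp: I_def cfg_def PiE_iff)
    have "op_apply I (Qminus n N) (dicke n N M) x
        = (\<Sum>j<N. if real ?K = M - 1 + J then of_real (real (n - x j) * dicke_weight n N x / ?C (Suc ?K)) else 0)"
      unfolding I_def total_op_apply[OF x[unfolded I_def]]
    proof (intro sum.cong refl)
      fix j assume "j \<in> {..<N}"
      then have xj: "x j \<le> n" and j: "j < N" using xle by auto
      show "(\<Sum>l\<le>n. spin_minus n (x j) l * dicke n N M (x(j := l)))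
          = (if real ?K = M - 1 + J then of_real (real (n - x j) * dicke_weight n N x / ?C (Suc ?K)) else 0)"
      proof (cases "x j = n")
        case True
        then show ?thesis by (auto simp: spin_minus_def intro!: sum.neutral)
      next
        case False
        then have m: "x j < n" using xj by simp
        have K: "sum (x(j := Suc (x j))) {..<N} = Suc ?K" using sum_upd[OF j, of x "Suc (x j)"] by simp
        have "(\<Sum>l\<le>n. spin_minus n (x j) l * dicke n N M (x(j := l)))
            = (\<Sum>l\<le>n. if l = Suc (x j) then spin_minus n (x j) (Suc (x j)) * dicke n N M (x(j := Suc (x j))) else 0)"
          by (intro sum.cong) (auto simp: spin_minus_def)
        also have "\<dots> = spin_minus n (x j) (Suc (x j)) * dicke n N M (x(j := Suc (x j)))" using m by simp
        also have "\<dots> = (if real ?K = M - 1 + J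
            then of_real (sqrt (real (n - x j) * real (Suc (x j))) * dicke_weight n N (x(j := Suc (x j))) / ?C (Suc ?K)) else 0)"
          unfolding spin_minus_Suc[OF m] dicke_def J_def[symmetric] K by auto
        also have "\<dots> = (if real ?K = M - 1 + J then of_real (real (n - x j) * dicke_weight n N x / ?C (Suc ?K)) else 0)"
          by (simp only: dicke_weight_minus[where x = x, OF j refl m])
        finally show ?thesis .
      qed
    qed
    also have "\<dots> = (if real ?K = M - 1 + J then of_real (real (\<Sum>j<N. n - x j) * dicke_weight n N x / ?C (Suc ?K)) else 0)"
      by (rule sum_if_collect)
    also have "(\<Sum>j<N. n - x j) = n * N - ?K"
      using xle by (subst sum_subtractf_nat) (auto simp: mult.commute)
    also have "(if real ?K = M - 1 + J then of_real (real (n * N - ?K) * dicke_weight n N x / ?C (Suc ?K)) else 0)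
        = of_real (sqrt ((J + M) * (J - M + 1))) * dicke n N (M - 1) x"
    proof (cases "real ?K = M - 1 + J")
      case True
      have Kle: "?K \<le> n * N" using sum_cfg_le x I_def by auto
      have e: "(J + M) * (J - M + 1) = real (n * N - ?K) * real (Suc ?K)"
      proof -
        have "real (n * N - ?K) = J - M + 1" "real (Suc ?K) = J + M"
          using True J2 Kle by (simp_all only: of_nat_diff of_nat_Suc)
        then show ?thesis by (simp only: mult.commute)
      qed
      have "real (n * N - ?K) * dicke_weight n N x / ?C (Suc ?K) = sqrt ((J + M) * (J - M + 1)) * (dicke_weight n N x / ?C ?K)"
      proof (cases "?K = n * N")
        case True
        then show ?thesis using e by simp
      next
        case False
        have l: "?K < n * N" using Kle False by simp
        have p: "?C ?K > 0" "?C (Suc ?K) > 0" using l by auto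
        have "?C (Suc ?K) * sqrt (real (n * N - ?K) * real (Suc ?K)) = ?C ?K * real (n * N - ?K)"
          by (rule sqrt_shift(2)[OF l])
        then have "real (n * N - ?K) / ?C (Suc ?K) = sqrt (real (n * N - ?K) * real (Suc ?K)) / ?C ?K"
          using p by (intro frac_shift)
        then have "real (n * N - ?K) / ?C (Suc ?K) * dicke_weight n N x = sqrt (real (n * N - ?K) * real (Suc ?K)) / ?C ?K * dicke_weight n N x"
          by (rule arg_cong)
        then show ?thesis unfolding e by simp
      qed
      then show ?thesis using True
        by (simp only: dicke_def J_def[symmetric] simp_thms if_True of_real_mult[symmetric])
    next
      case False
      then show ?thesis by (simp add: dicke_def J_def)
    qed
    finally show ?thesis .
  qed
  show ?thesis
    unfolding top_multiplet_def Let_def J_def[symmetric] I_def[symmetric]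
    using inner qz qp qm by blast
qed

end

theory Submission
  imports Defs
begin

text \<open>
  Group the lost configurations by the lost set \<open>\<alpha>\<close> and their total level \<open>l\<close>. Because \<open>|J, M\<rangle>\<close> and
  \<open>|J, -M\<rangle>\<close> are Dicke states and \<open>2 M\<close> exceeds every possible \<open>l\<close>, the erased probe state is a
  mixture of pure qubit states with pairwise disjoint supports. With \<open>n = 2 s\<close>, \<open>t = n |\<alpha>|\<close>,
  \<open>m = n N - t\<close>, \<open>D = 2 M\<close> and \<open>K = J + M\<close>, the two levels of block \<open>(\<alpha>, l)\<close> have hypergeometric
  weights \<open>p\<^sub>\<alpha> A\<^sub>l / 2\<close> and \<open>p\<^sub>\<alpha> B\<^sub>l / 2\<close>, where \<open>B\<^sub>l = A\<^bsub>t - l\<^esub>\<close>, and the Fisher information is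
  \<open>2 D\<^sup>2 \<Sum>\<^sub>\<alpha> p\<^sub>\<alpha> \<Sum>\<^sub>l A\<^sub>l B\<^sub>l / (A\<^sub>l + B\<^sub>l)\<close>. The inner sum is at most \<open>1/2\<close>. Successive binomial
  coefficients satisfy \<open>(C\<^sub>k - C\<^bsub>k+1\<^esub>) / (C\<^sub>k + C\<^bsub>k+1\<^esub>) = (2 k + 1 - m) / (m + 1)\<close>, whence
  \<open>(A\<^sub>l - B\<^sub>l)\<^sup>2 / (A\<^sub>l + B\<^sub>l) \<le> (A\<^sub>l - B\<^sub>l) (2 l - t) D / (m + 1)\<close>. Summing over \<open>l\<close> involves only the
  hypergeometric mean, and shows that the inner sum falls short of \<open>1/2\<close> by
  \<open>O(|\<alpha>| M\<^sup>2 / N\<^sup>2) = O(N powr (c + 2 b - 2))\<close>, which vanishes.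
\<close>

section \<open>Overlap of two hypergeometric distributions\<close>

text \<open>
  Relative differences \<open>(p - q) / (p + q)\<close> compose like velocities, hence subadditively. This
  avoids logarithms of binomial ratios.
\<close>

lemma relative_difference_subadditive:
  fixes p q r s t :: real
  assumes "0 \<le> s" "0 \<le> t" "0 \<le> p" "0 \<le> r"
    and pq: "p - q \<le> s * (p + q)" and qr: "q - r \<le> t * (q + r)"
  shows "p - r \<le> (s + t) * (p + r)"
proof (cases "s + t < 1 \<and> r < p")
  case True
  have "(1 - t) * ((1 - s) * p) \<le> (1 - t) * ((1 + s) * q)"
    using True assms by (intro mult_left_mono) (auto simp: algebra_simps)
  also have "\<dots> = (1 + s) * ((1 - t) * q)" by simp
  also have "\<dots> \<le> (1 + s) * ((1 + t) * r)"
    using assms by (intro mult_left_mono) (auto simp: algebra_simps)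
  finally have "(1 + s * t) * (p - r) \<le> (s + t) * (p + r)" by (simp add: algebra_simps)
  moreover have "0 \<le> s * t * (p - r)" using True assms by simp
  ultimately show ?thesis by (simp add: algebra_simps)
next
  case False
  then consider "1 \<le> s + t" | "p \<le> r" by linarith
  then show ?thesis
  proof cases
    case 1
    have "p - r \<le> 1 * (p + r)" using assms by simp
    also have "\<dots> \<le> (s + t) * (p + r)" using 1 assms by (intro mult_right_mono) auto
    finally show ?thesis .
  next
    case 2
    have "0 \<le> (s + t) * (p + r)" using assms by simp
    then show ?thesis using 2 by linarith
  qed
qed

text \<open>Induction on \<open>j\<close>: passing from \<open>k\<close> to \<open>Suc k\<close>
  contributes \<open>(2 * k + 1 - m) / (m + 1)\<close>, and the sum of \<open>2 * k + 1 - m\<close>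
  over \<open>i \<le> k < j\<close> is \<open>(j - i) * (i + j - m)\<close>. The hypothesis
  \<open>m \<le> 2 * i\<close> makes every contribution nonnegative, as subadditivity
  requires.\<close>

lemma binomial_relative_difference:
  assumes "m \<le> 2 * i" "i \<le> j"
  shows "real (m choose i) - real (m choose j)
    \<le> (real j - real i) * (real i + real j - real m) / (real m + 1)
      * (real (m choose i) + real (m choose j))"
  using assms(2)
proof (induction j rule: dec_induct)
  case base
  then show ?case by simp
next
  case (step j)
  have j: "real m \<le> 2 * real j" "real i \<le> real j" using assms(1) step(1) by linarith+
  have consecutive: "real (m choose j) - real (m choose Suc j)
      = (2 * real j + 1 - real m) / (real m + 1) * (real (m choose j) + real (m choose Suc j))"
  proof (cases "j \<le> m")
    case True
    have "real (m choose Suc j) * (real j + 1) = real (m choose j) * (real m - real j)"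
      using arg_cong[OF binomial_shift[of m j], of real] True by (simp add: of_nat_diff algebra_simps)
    then show ?thesis by (simp add: field_simps)
  next
    case False
    then show ?thesis by (simp add: binomial_eq_0)
  qed
  have "real (m choose i) - real (m choose Suc j)
    \<le> ((real j - real i) * (real i + real j - real m) / (real m + 1)
        + (2 * real j + 1 - real m) / (real m + 1))
      * (real (m choose i) + real (m choose Suc j))"
    by (rule relative_difference_subadditive[OF _ _ _ _ step.IH eq_refl[OF consecutive]])
      (use j assms(1) in \<open>auto intro!: divide_nonneg_nonneg mult_nonneg_nonneg\<close>)
  also have "(real j - real i) * (real i + real j - real m) / (real m + 1)
        + (2 * real j + 1 - real m) / (real m + 1)
      = (real (Suc j) - real i) * (real i + real (Suc j) - real m) / (real m + 1)"
    by (simp add: add_divide_distrib[symmetric] algebra_simps)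
  finally show ?case .
qed

lemma binomial_decreasing:
  assumes "m \<le> 2 * i" "i \<le> j"
  shows "(m choose j) \<le> (m choose i)"
proof (cases "j \<le> m")
  case True
  then show ?thesis using assms by (intro binomial_antimono) auto
qed (simp add: binomial_eq_0)

section \<open>Vandermonde sums and moments of the hypergeometric distribution\<close>

lemma vandermonde_atMost:
  assumes "t \<le> K"
  shows "(\<Sum>l\<le>t. (t choose l) * (m choose (K - l))) = (t + m choose K)"
proof -
  have "(\<Sum>l\<le>t. (t choose l) * (m choose (K - l))) = (\<Sum>l\<le>K. (t choose l) * (m choose (K - l)))"
    using assms by (intro sum.mono_neutral_left) (auto simp: binomial_eq_0)
  then show ?thesis by (simp add: vandermonde)
qed

text \<open>Absorbing the factor \<open>l\<close> into \<open>t choose l\<close> reduces the sum to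
  Vandermonde for \<open>t - 1\<close> and \<open>K - 1\<close>; a second absorption restores
  \<open>t + m choose K\<close>. Clearing the denominator \<open>t + m\<close> keeps the identity in
  the natural numbers.\<close>

lemma vandermonde_mean:
  assumes "t \<le> K"
  shows "(t + m) * (\<Sum>l\<le>t. l * ((t choose l) * (m choose (K - l)))) = t * K * (t + m choose K)"
proof (cases t)
  case (Suc t')
  obtain K' where K: "K = Suc K'" using Suc assms by (cases K) auto
  have "(\<Sum>l\<le>t. l * ((t choose l) * (m choose (K - l))))
      = (\<Sum>l\<le>t'. (Suc l * (Suc t' choose Suc l)) * (m choose (K' - l)))"
    unfolding Suc sum.atMost_Suc_shift by (simp add: K mult.assoc del: binomial_Suc_Suc mult_Suc)
  also have "\<dots> = t * (\<Sum>l\<le>t'. (t' choose l) * (m choose (K' - l)))"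
    unfolding binomial_absorption by (simp add: Suc sum_distrib_left mult.assoc del: mult_Suc)
  also have "\<dots> = t * (t' + m choose K')"
    using vandermonde_atMost[of t' K' m] assms Suc K by simp
  finally have "(t + m) * (\<Sum>l\<le>t. l * ((t choose l) * (m choose (K - l))))
      = t * ((t + m) * (t' + m choose K'))" by simp
  also have "(t + m) * (t' + m choose K') = K * (t + m choose K)"
    using binomial_absorption[of K' "t + m"] Suc K by simp
  finally show ?thesis by (simp add: mult.assoc)
qed simp

text \<open>The chance that \<open>K\<close> draws from \<open>t + m\<close> items hit
  \<open>l\<close> of the \<open>t\<close> marked ones. For \<open>l > K\<close> the truncated
  \<open>K - l\<close> is 0 and the value is no longer this probability, which is why normalisation,
  mean and reflection below assume \<open>t \<le> K\<close>.\<close>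

definition hypergeom :: "nat \<Rightarrow> nat \<Rightarrow> nat \<Rightarrow> nat \<Rightarrow> real" where
  "hypergeom t m K l = real (t choose l) * real (m choose (K - l)) / real (t + m choose K)"

lemma hypergeom_nonneg: "0 \<le> hypergeom t m K l"
  by (simp add: hypergeom_def)

lemma sum_hypergeom:
  assumes "t \<le> K" "K \<le> t + m"
  shows "(\<Sum>l\<le>t. hypergeom t m K l) = 1"
proof -
  have "(\<Sum>l\<le>t. hypergeom t m K l)
      = real (\<Sum>l\<le>t. (t choose l) * (m choose (K - l))) / real (t + m choose K)"
    by (simp add: hypergeom_def sum_divide_distrib)
  then show ?thesis using assms by (simp add: vandermonde_atMost)
qed

lemma mean_hypergeom:
  assumes "t \<le> K" "K \<le> t + m" "0 < t + m"
  shows "(\<Sum>l\<le>t. hypergeom t m K l * real l) = real t * real K / real (t + m)"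
proof -
  have "(\<Sum>l\<le>t. hypergeom t m K l * real l)
      = real (\<Sum>l\<le>t. l * ((t choose l) * (m choose (K - l)))) / real (t + m choose K)"
    unfolding hypergeom_def of_nat_sum sum_divide_distrib by (intro sum.cong) simp_all
  moreover have "real (t + m) * real (\<Sum>l\<le>t. l * ((t choose l) * (m choose (K - l))))
      = real t * real K * real (t + m choose K)"
    unfolding of_nat_mult[symmetric] vandermonde_mean[OF assms(1)] ..
  moreover have "real (t + m choose K) > 0" using assms by simp
  moreover have "X = u / T" if "X = S / C" "T * S = u * C" "0 < C" "0 < T" for X u T S C :: real
  proof -
    have "S = u * C / T" using that by (simp add: eq_divide_eq mult.commute)
    then show ?thesis using that by simp
  qed
  ultimately show ?thesis using assms(3) by (metis of_nat_0_less_iff)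
qed

text \<open>Passing to the complementary draw turns \<open>l\<close> into \<open>t - l\<close>, and
  each of the three binomial coefficients is symmetric. This ties the weights coming from
  \<open>|J, -M>\<close> to those coming from \<open>|J, M>\<close>.\<close>

lemma hypergeom_reflect:
  assumes "t \<le> K" "K \<le> m" "l \<le> t"
  shows "hypergeom t m (t + m - K) l = hypergeom t m K (t - l)"
proof -
  have "t + m - K - l = m - (K - (t - l))" using assms by simp
  then have "(m choose (t + m - K - l)) = (m choose (K - (t - l)))"
    using binomial_symmetric[of "K - (t - l)" m] assms by simp
  moreover have "(t + m choose (t + m - K)) = (t + m choose K)"
    using binomial_symmetric[of K "t + m"] assms by simp
  moreover have "(t choose (t - l)) = (t choose l)" using binomial_symmetric[of l t] assms by simp
  ultimately show ?thesis by (simp add: hypergeom_def)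
qed

text \<open>Each term is \<open>(A + B) / 4\<close> minus
  \<open>(A - B)\<^sup>2 / (A + B) / 4\<close>. The relative-difference bound replaces one factor
  \<open>A - B\<close> of the square by a multiple of \<open>A + B\<close> that is linear in
  \<open>l\<close>, after which only the totals and the means of both distributions enter.\<close>

lemma hypergeom_overlap:
  assumes "2 * K = t + m + D" "t < D" "K \<le> m"
  defines "A \<equiv> hypergeom t m K" and "B \<equiv> hypergeom t m (K - D)"
  shows "(\<Sum>l\<le>t. A l * B l / (A l + B l)) \<le> 1 / 2"
    and "1 / 2 - real t * (real D)\<^sup>2 / (2 * real (t + m) * (real m + 1))
      \<le> (\<Sum>l\<le>t. A l * B l / (A l + B l))"
proof -
  have tK: "t \<le> K" "t < K - D + 1" "K - D = t + m - K" "0 < t + m" using assms by linarith+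
  have B: "B l = A (t - l)" if "l \<le> t" for l
    using hypergeom_reflect[of t K m l] tK assms(3) that by (simp add: A_def B_def)
  have nn: "0 \<le> A l" "0 \<le> B l" for l by (simp_all add: A_def B_def hypergeom_nonneg)
  have one: "(\<Sum>l\<le>t. A l) = 1" "(\<Sum>l\<le>t. B l) = 1"
    unfolding A_def B_def by (intro sum_hypergeom; use tK assms in linarith)+
  have mean: "(\<Sum>l\<le>t. A l * real l) = real t * real K / real (t + m)"
     "(\<Sum>l\<le>t. B l * real l) = real t * real (K - D) / real (t + m)"
    unfolding A_def B_def by (intro mean_hypergeom; use tK assms in linarith)+
  \<comment> \<open>The indices \<open>K - l\<close> and \<open>K - (t - l)\<close> differ by
    \<open>2 * l - t\<close> and add up to \<open>m + D\<close>, so the relative difference of their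
    binomials is at most \<open>(2 * l - t) * \<epsilon>\<close>.\<close>
  define \<epsilon> where "\<epsilon> = real D / (real m + 1)"
  \<comment> \<open>No division by \<open>A l + B l\<close>, which may be 0; in that case the second
    conjunct settles the final estimate. The condition \<open>t \<le> 2 * l\<close> orders the two
    binomial indices, and \<open>t < D\<close> keeps the smaller one at or above
    \<open>m / 2\<close>.\<close>
  have half: "(A l - B l)\<^sup>2 \<le> (A l + B l) * ((A l - B l) * (2 * real l - real t) * \<epsilon>) \<and> 0 \<le> (A l - B l) * (2 * real l - real t) * \<epsilon>"
    if l: "l \<le> t" "t \<le> 2 * l" for l
  proof -
    let ?b = "\<lambda>k. real (m choose k)"
    have ij: "m \<le> 2 * (K - l)" "K - l \<le> K - (t - l)" using assms tK l by linarith+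
    have eqA: "A l = real (t choose l) / real (t + m choose K) * ?b (K - l)"
      by (simp add: A_def hypergeom_def)
    have eqB: "B l = real (t choose l) / real (t + m choose K) * ?b (K - (t - l))"
      using l binomial_symmetric[of l t] by (simp add: A_def B hypergeom_def)
    have scaled: "c * p - c * q \<le> s * (c * p + c * q)"
      if "p - q \<le> s * (p + q)" "0 \<le> c" for c p q s :: real
      using mult_left_mono[OF that] by (simp add: algebra_simps)
    have "?b (K - l) - ?b (K - (t - l)) \<le> (2 * real l - real t) * \<epsilon> * (?b (K - l) + ?b (K - (t - l)))"
    proof -
      have "(real (K - (t - l)) - real (K - l)) * (real (K - l) + real (K - (t - l)) - real m)
        = (2 * real l - real t) * real D"
      proof (rule arg_cong2[where f = "(*)"])
        show "real (K - (t - l)) - real (K - l) = 2 * real l - real t"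
          using l tK by (simp add: of_nat_diff)
        have "(K - l) + (K - (t - l)) = m + D" using l tK assms by linarith
        then show "real (K - l) + real (K - (t - l)) - real m = real D" by linarith
      qed
      then show ?thesis using binomial_relative_difference[OF ij] by (simp add: \<epsilon>_def)
    qed
    then have "A l - B l \<le> (2 * real l - real t) * \<epsilon> * (A l + B l)"
      unfolding eqA eqB by (rule scaled) simp
    moreover have "B l \<le> A l"
      unfolding eqA eqB by (intro mult_left_mono) (use binomial_decreasing[OF ij] in auto)
    ultimately have "(A l - B l) * (A l - B l) \<le> (A l - B l) * ((2 * real l - real t) * \<epsilon> * (A l + B l))"
      and "0 \<le> A l - B l" by (auto intro: mult_left_mono)
    moreover have "0 \<le> \<epsilon>" by (simp add: \<epsilon>_def)
    ultimately show ?thesis using l by (simp add: power2_eq_square mult_ac)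
  qed
  \<comment> \<open>Below the middle, the reflection of \<open>l\<close> to \<open>t - l\<close>
    exchanges \<open>A\<close> and \<open>B\<close>; both \<open>A l - B l\<close> and
    \<open>2 * l - t\<close> change sign, so their product is unchanged.\<close>
  have all: "(A l - B l)\<^sup>2 \<le> (A l + B l) * ((A l - B l) * (2 * real l - real t) * \<epsilon>) \<and> 0 \<le> (A l - B l) * (2 * real l - real t) * \<epsilon>"
    if l: "l \<le> t" for l
  proof (cases "t \<le> 2 * l")
    case False
    have "A (t - l) = B l" "B (t - l) = A l" using B[of l] B[of "t - l"] l by auto
    moreover have "2 * real (t - l) - real t = - (2 * real l - real t)" using l by (simp add: of_nat_diff)
    moreover have "(B l - A l)\<^sup>2 = (A l - B l)\<^sup>2" "B l + A l = A l + B l"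
      "(B l - A l) * - (2 * real l - real t) = (A l - B l) * (2 * real l - real t)"
      by (simp_all add: power2_eq_square algebra_simps)
    moreover have "t \<le> 2 * (t - l)" "t - l \<le> t" using False by linarith+
    ultimately show ?thesis using half[of "t - l"] by (simp only: add.commute)
  qed (use half l in auto)
  \<comment> \<open>If the denominator is 0, both weights vanish by nonnegativity and both sides are
    0.\<close>
  have term_eq: "A l * B l / (A l + B l) = (A l + B l) / 4 - (A l - B l)\<^sup>2 / (A l + B l) / 4" for l
  proof (cases "A l + B l = 0")
    case True
    then show ?thesis using nn[of l] by simp
  next
    case False
    then show ?thesis by (simp add: field_simps power2_eq_square)
  qed
  have sum4: "(\<Sum>l\<le>t. (A l + B l) / 4) = 1 / 2"
    by (simp add: sum_divide_distrib[symmetric] sum.distrib one)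
  have "(\<Sum>l\<le>t. A l * B l / (A l + B l)) \<le> (\<Sum>l\<le>t. (A l + B l) / 4)"
  proof (intro sum_mono)
    fix l
    have "0 \<le> (A l - B l)\<^sup>2 / (A l + B l) / 4" using nn[of l] by simp
    then show "A l * B l / (A l + B l) \<le> (A l + B l) / 4"
      unfolding term_eq by (simp only: diff_le_eq le_add_same_cancel1)
  qed
  then show "(\<Sum>l\<le>t. A l * B l / (A l + B l)) \<le> 1 / 2" using sum4 by simp
  \<comment> \<open>Both totals are 1, so the terms with \<open>t\<close> cancel and twice the
    difference of the means remains.\<close>
  have "(\<Sum>l\<le>t. (A l - B l) * (2 * real l - real t)) = 2 * (\<Sum>l\<le>t. A l * real l) - 2 * (\<Sum>l\<le>t. B l * real l)
      - real t * (\<Sum>l\<le>t. A l) + real t * (\<Sum>l\<le>t. B l)"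
    by (simp only: sum_distrib_left sum_subtractf[symmetric] sum.distrib[symmetric]) (simp add: algebra_simps)
  also have "\<dots> = 2 * real t * real D / real (t + m)"
  proof -
    have "D \<le> K" using assms tK by linarith
    then show ?thesis
      unfolding one mean by (simp add: of_nat_diff diff_divide_distrib[symmetric] algebra_simps)
  qed
  finally have mean_diff: "(\<Sum>l\<le>t. (A l - B l) * (2 * real l - real t)) = 2 * real t * real D / real (t + m)" .
  have arrange: "real t * (real D)\<^sup>2 / (2 * a * c) = 2 * real t * real D / a * (real D / c) / 4"
    if "0 < a" "0 < c" for a c :: real
    using that by (simp add: field_simps power2_eq_square)
  have "1 / 2 - real t * (real D)\<^sup>2 / (2 * real (t + m) * (real m + 1))
      = (\<Sum>l\<le>t. (A l + B l) / 4) - (\<Sum>l\<le>t. (A l - B l) * (2 * real l - real t)) * \<epsilon> / 4"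
    unfolding sum4 mean_diff \<epsilon>_def using arrange[of "real (t + m)" "real m + 1"] tK by simp
  also have "\<dots> = (\<Sum>l\<le>t. (A l + B l) / 4 - (A l - B l) * (2 * real l - real t) * \<epsilon> / 4)"
    by (simp add: sum_subtractf sum_distrib_right sum_divide_distrib)
  also have "\<dots> \<le> (\<Sum>l\<le>t. A l * B l / (A l + B l))"
    unfolding term_eq
  proof (intro sum_mono diff_left_mono divide_right_mono)
    fix l assume "l \<in> {..t}"
    then have a: "(A l - B l)\<^sup>2 \<le> (A l + B l) * ((A l - B l) * (2 * real l - real t) * \<epsilon>)"
      "0 \<le> (A l - B l) * (2 * real l - real t) * \<epsilon>" using all by auto
    show "(A l - B l)\<^sup>2 / (A l + B l) \<le> (A l - B l) * (2 * real l - real t) * \<epsilon>"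
    proof (cases "A l + B l = 0")
      case False
      then have "A l + B l > 0" using nn[of l] by linarith
      then show ?thesis using a(1) by (simp add: pos_divide_le_eq mult.commute)
    qed (use a(2) in simp)
  qed simp
  finally show "1 / 2 - real t * (real D)\<^sup>2 / (2 * real (t + m) * (real m + 1))
      \<le> (\<Sum>l\<le>t. A l * B l / (A l + B l))" .
qed

section \<open>Fisher information of a mixture with disjoint supports\<close>

text \<open>
  On a pure block \<open>v v\<^sup>\<dagger>\<close> of weight \<open>\<nu> = \<parallel>v\<parallel>\<^sup>2\<close>, differentiating \<open>\<rho>\<^sup>2 = \<nu> \<rho>\<close> shows that
  \<open>2 d\<rho> / \<nu>\<close> is a symmetric logarithmic derivative. A null block has \<open>v = 0\<close>, so division by
  zero is harmless there.
\<close>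

lemma qfi_disjoint_supports:
  fixes v :: "'l \<Rightarrow> 'i ket" and g :: "'i \<Rightarrow> real"
  assumes fin: "finite I" "finite L"
    and disj: "\<And>j j' x. j \<in> L \<Longrightarrow> j' \<in> L \<Longrightarrow> x \<in> I \<Longrightarrow> j \<noteq> j' \<Longrightarrow> v j x = 0 \<or> v j' x = 0"
    and \<rho>: "\<And>x y. x \<in> I \<Longrightarrow> y \<in> I \<Longrightarrow> \<rho> x y = (\<Sum>j\<in>L. v j x * cnj (v j y))"
    and d\<rho>: "\<And>x y. x \<in> I \<Longrightarrow> y \<in> I \<Longrightarrow> d\<rho> x y = - \<i> * of_real (g x - g y) * \<rho> x y"
  shows "\<exists>R. is_SLD I \<rho> d\<rho> R"
    and "qfi I \<rho> d\<rho> = (\<Sum>j\<in>L. 2 * (\<Sum>x\<in>I. \<Sum>y\<in>I. (g x - g y)\<^sup>2 * (cmod (v j x))\<^sup>2 * (cmod (v j y))\<^sup>2)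
      / (\<Sum>x\<in>I. (cmod (v j x))\<^sup>2))"
proof -
  define \<nu> where "\<nu> j = (\<Sum>x\<in>I. (cmod (v j x))\<^sup>2)" for j
  define R where "R x y = (\<Sum>j\<in>L. of_real (2 / \<nu> j) * (- \<i> * of_real (g x - g y)) * (v j x * cnj (v j y)))" for x y
  have null: "v j x = 0" if "\<nu> j = 0" "x \<in> I" for j x
    using that fin(1) by (auto simp: \<nu>_def sum_nonneg_eq_0_iff)
  \<comment> \<open>At a given \<open>z\<close> at most one component is nonzero, so the cross terms
    of the product vanish.\<close>
  have collapse: "(\<Sum>j\<in>L. a j * cnj (v j z)) * (\<Sum>j\<in>L. b j * v j z) = (\<Sum>j\<in>L. a j * b j * of_real ((cmod (v j z))\<^sup>2))"
    if z: "z \<in> I" for a b z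
  proof -
    have "(\<Sum>j\<in>L. a j * cnj (v j z)) * (\<Sum>j\<in>L. b j * v j z)
        = (\<Sum>j\<in>L. \<Sum>j'\<in>L. a j * cnj (v j z) * (b j' * v j' z))"
      by (simp add: sum_product)
    also have "\<dots> = (\<Sum>j\<in>L. \<Sum>j'\<in>L. if j' = j then a j * cnj (v j z) * (b j * v j z) else 0)"
    proof (intro sum.cong refl)
      fix j j' assume "j \<in> L" "j' \<in> L"
      then show "a j * cnj (v j z) * (b j' * v j' z) = (if j' = j then a j * cnj (v j z) * (b j * v j z) else 0)"
        using disj[of j j' z] z by (cases "j = j'") auto
    qed
    also have "\<dots> = (\<Sum>j\<in>L. a j * b j * of_real ((cmod (v j z))\<^sup>2))"
      using fin(2) by (simp add: complex_norm_square mult_ac del: of_real_power)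
    finally show ?thesis .
  qed
  have SLD: "is_SLD I \<rho> d\<rho> R"
    unfolding is_SLD_def
  proof (intro conjI ballI)
    show "op_hermitian I R"
      unfolding op_hermitian_def R_def
      by (intro ballI) (simp only: cnj_sum, rule sum.cong, auto simp: algebra_simps)
  next
    fix x y assume xy: "x \<in> I" "y \<in> I"
    have "op_mult I \<rho> R x y = (\<Sum>z\<in>I. \<Sum>j\<in>L. v j x * (of_real (2 / \<nu> j) * (- \<i> * of_real (g z - g y)) * cnj (v j y)) * of_real ((cmod (v j z))\<^sup>2))"
      unfolding op_mult_def
    proof (rule sum.cong[OF refl])
      fix z assume z: "z \<in> I"
      show "\<rho> x z * R z y = (\<Sum>j\<in>L. v j x * (of_real (2 / \<nu> j) * (- \<i> * of_real (g z - g y)) * cnj (v j y)) * of_real ((cmod (v j z))\<^sup>2))"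
        unfolding collapse[OF z, symmetric] \<rho>[OF xy(1) z] R_def
        by (rule arg_cong2[where f = "(*)"]; rule sum.cong[OF refl]; simp add: mult_ac)
    qed
    moreover have "op_mult I R \<rho> x y = (\<Sum>z\<in>I. \<Sum>j\<in>L. (of_real (2 / \<nu> j) * (- \<i> * of_real (g x - g z)) * v j x) * cnj (v j y) * of_real ((cmod (v j z))\<^sup>2))"
      unfolding op_mult_def
    proof (rule sum.cong[OF refl])
      fix z assume z: "z \<in> I"
      show "R x z * \<rho> z y = (\<Sum>j\<in>L. (of_real (2 / \<nu> j) * (- \<i> * of_real (g x - g z)) * v j x) * cnj (v j y) * of_real ((cmod (v j z))\<^sup>2))"
        unfolding collapse[OF z, symmetric] \<rho>[OF z xy(2)] R_def
        by (rule arg_cong2[where f = "(*)"]; rule sum.cong[OF refl]; simp add: mult_ac)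
    qed
    \<comment> \<open>The intermediate point drops out, since
      \<open>(g z - g y) + (g x - g z) = g x - g y\<close>. What remains of the sum over
      \<open>z\<close> is \<open>\<nu> j\<close>, which cancels the denominator in
      \<open>R\<close>.\<close>
    ultimately have "op_mult I \<rho> R x y + op_mult I R \<rho> x y
      = (\<Sum>z\<in>I. \<Sum>j\<in>L. (of_real (2 / \<nu> j) * (- \<i> * of_real (g x - g y)) * (v j x * cnj (v j y))) * of_real ((cmod (v j z))\<^sup>2))"
      by (simp only: sum.distrib[symmetric]) (intro sum.cong refl, simp add: algebra_simps)
    also have "\<dots> = (\<Sum>j\<in>L. \<Sum>z\<in>I. (of_real (2 / \<nu> j) * (- \<i> * of_real (g x - g y)) * (v j x * cnj (v j y))) * of_real ((cmod (v j z))\<^sup>2))"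
      by (rule sum.swap)
    also have "\<dots> = (\<Sum>j\<in>L. 2 * (- \<i> * of_real (g x - g y)) * (v j x * cnj (v j y)))"
    proof (rule sum.cong[OF refl])
      fix j assume "j \<in> L"
      have "(\<Sum>z\<in>I. (of_real (2 / \<nu> j) * (- \<i> * of_real (g x - g y)) * (v j x * cnj (v j y))) * of_real ((cmod (v j z))\<^sup>2))
        = of_real (2 / \<nu> j) * (- \<i> * of_real (g x - g y)) * (v j x * cnj (v j y)) * of_real (\<nu> j)"
        by (simp only: sum_distrib_left[symmetric] \<nu>_def of_real_sum)
      also have "\<dots> = 2 * (- \<i> * of_real (g x - g y)) * (v j x * cnj (v j y))"
        using null[OF _ xy(1)] by (cases "\<nu> j = 0") (auto simp: mult_ac)
      finally show "(\<Sum>z\<in>I. (of_real (2 / \<nu> j) * (- \<i> * of_real (g x - g y)) * (v j x * cnj (v j y))) * of_real ((cmod (v j z))\<^sup>2))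
        = 2 * (- \<i> * of_real (g x - g y)) * (v j x * cnj (v j y))" .
    qed
    also have "\<dots> = 2 * d\<rho> x y"
      unfolding d\<rho>[OF xy] \<rho>[OF xy] sum_distrib_left by (intro sum.cong refl) (simp only: mult_ac)
    finally show "op_mult I \<rho> R x y + op_mult I R \<rho> x y = 2 * d\<rho> x y" .
  qed
  then show "\<exists>R. is_SLD I \<rho> d\<rho> R" by blast
  \<comment> \<open>Pairing the defining equation of \<open>R\<close> with \<open>R\<close> itself
    trades the trace of \<open>\<rho> R R\<close> for that of \<open>d\<rho> R\<close>, which is
    only linear in \<open>R\<close>.\<close>
  have "qfi I \<rho> d\<rho> = Re (op_trace I (op_mult I d\<rho> R))"
    using qfi_eq[OF SLD] SLD_trace_pairing[OF SLD, of R] by simp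
  also have "op_trace I (op_mult I d\<rho> R)
      = (\<Sum>x\<in>I. \<Sum>y\<in>I. \<Sum>j\<in>L. of_real (2 / \<nu> j * ((g x - g y)\<^sup>2 * (cmod (v j x))\<^sup>2 * (cmod (v j y))\<^sup>2)))"
    unfolding op_trace_def op_mult_def
  proof (intro sum.cong[OF refl])
    fix x y assume xy: "x \<in> I" "y \<in> I"
    have "d\<rho> x y * R y x = (\<Sum>j\<in>L. (- \<i> * of_real (g x - g y) * v j x) * cnj (v j y))
        * (\<Sum>j\<in>L. (of_real (2 / \<nu> j) * (- \<i> * of_real (g y - g x)) * cnj (v j x)) * v j y)"
    proof (rule arg_cong2[where f = "(*)"])
      show "d\<rho> x y = (\<Sum>j\<in>L. (- \<i> * of_real (g x - g y) * v j x) * cnj (v j y))"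
        unfolding d\<rho>[OF xy] \<rho>[OF xy] sum_distrib_left by (intro sum.cong refl) (simp only: mult_ac)
      show "R y x = (\<Sum>j\<in>L. (of_real (2 / \<nu> j) * (- \<i> * of_real (g y - g x)) * cnj (v j x)) * v j y)"
        unfolding R_def by (intro sum.cong refl) (simp only: mult_ac)
    qed
    also have "\<dots> = (\<Sum>j\<in>L. of_real (2 / \<nu> j * ((g x - g y)\<^sup>2 * (cmod (v j x))\<^sup>2 * (cmod (v j y))\<^sup>2)))"
      unfolding collapse[OF xy(2)]
    proof (rule sum.cong[OF refl])
      fix j
      have "of_real ((cmod (v j x))\<^sup>2) = v j x * cnj (v j x)" by (rule complex_norm_square)
      moreover have "of_real ((g x - g y)\<^sup>2) = (- \<i> * of_real (g x - g y)) * (- \<i> * complex_of_real (g y - g x))"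
        by (simp add: power2_eq_square algebra_simps)
      ultimately show "(- \<i> * of_real (g x - g y) * v j x) * (of_real (2 / \<nu> j) * (- \<i> * of_real (g y - g x)) * cnj (v j x)) * of_real ((cmod (v j y))\<^sup>2)
        = of_real (2 / \<nu> j * ((g x - g y)\<^sup>2 * (cmod (v j x))\<^sup>2 * (cmod (v j y))\<^sup>2))"
        unfolding of_real_mult by (simp only: mult_ac)
    qed
    finally show "d\<rho> x y * R y x = (\<Sum>j\<in>L. of_real (2 / \<nu> j * ((g x - g y)\<^sup>2 * (cmod (v j x))\<^sup>2 * (cmod (v j y))\<^sup>2)))" .
  qed
  also have "\<dots> = (\<Sum>x\<in>I. \<Sum>j\<in>L. \<Sum>y\<in>I. of_real (2 / \<nu> j * ((g x - g y)\<^sup>2 * (cmod (v j x))\<^sup>2 * (cmod (v j y))\<^sup>2)))"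
    by (intro sum.cong refl sum.swap)
  also have "\<dots> = (\<Sum>j\<in>L. \<Sum>x\<in>I. \<Sum>y\<in>I. of_real (2 / \<nu> j * ((g x - g y)\<^sup>2 * (cmod (v j x))\<^sup>2 * (cmod (v j y))\<^sup>2)))"
    by (rule sum.swap)
  also have "\<dots> = of_real (\<Sum>j\<in>L. 2 * (\<Sum>x\<in>I. \<Sum>y\<in>I. (g x - g y)\<^sup>2 * (cmod (v j x))\<^sup>2 * (cmod (v j y))\<^sup>2) / \<nu> j)"
    by (simp only: of_real_sum[symmetric] sum_distrib_left sum_divide_distrib times_divide_eq_left)
  finally show "qfi I \<rho> d\<rho> = (\<Sum>j\<in>L. 2 * (\<Sum>x\<in>I. \<Sum>y\<in>I. (g x - g y)\<^sup>2 * (cmod (v j x))\<^sup>2 * (cmod (v j y))\<^sup>2)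
      / (\<Sum>x\<in>I. (cmod (v j x))\<^sup>2))"
    by (simp only: Re_complex_of_real \<nu>_def)
qed

section \<open>Matrix entries of the probe state\<close>

lemma Qz_entry:
  assumes "x \<in> cfg n {..<N}" "y \<in> cfg n {..<N}"
  shows "Qz n N x y = (if x = y then of_real (real (sum x {..<N}) - real n / 2 * real N) else 0)"
proof -
  have eq: "x = y \<longleftrightarrow> (\<forall>i<N. x i = y i)"
    using assms unfolding cfg_def by (metis PiE_ext lessThan_iff)
  have "site_op {..<N} j (spin_z n) x y = (if x = y then of_real (real (x j) - real n / 2) else 0)"
    if "j < N" for j
    using eq that unfolding site_op_def spin_z_def by auto
  then have "Qz n N x y = (\<Sum>j<N. if x = y then of_real (real (x j) - real n / 2) else 0)"
    by (simp add: total_op_def)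
  then show ?thesis by (simp add: sum_subtractf)
qed

lemma op_apply_Qz:
  assumes "x \<in> cfg n {..<N}"
  shows "op_apply (cfg n {..<N}) (Qz n N) u x
    = of_real (real (sum x {..<N}) - real n / 2 * real N) * u x"
proof -
  have "op_apply (cfg n {..<N}) (Qz n N) u x
      = (\<Sum>y\<in>cfg n {..<N}. if y = x then of_real (real (sum x {..<N}) - real n / 2 * real N) * u x else 0)"
    unfolding op_apply_def by (intro sum.cong refl) (use assms in \<open>auto simp: Qz_entry\<close>)
  then show ?thesis using assms by (simp add: finite_cfg)
qed

lemma op_exp_diagonal:
  assumes "finite I" "\<And>x y. x \<in> I \<Longrightarrow> y \<in> I \<Longrightarrow> A x y = (if x = y then e x else 0)"
    and "x \<in> I" "y \<in> I"
  shows "op_exp I A x y = (if x = y then exp (e x) else 0)"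
proof -
  have "op_power I A k x y = (if x = y then e x ^ k else 0)" for k
    using assms(3,4)
  proof (induction k arbitrary: x y)
    case (Suc k)
    have "op_power I A (Suc k) x y = (\<Sum>z\<in>I. if z = x then e x * op_power I A k x y else 0)"
      unfolding op_power.simps op_mult_def
      by (intro sum.cong refl) (use assms(2) Suc.prems in auto)
    then show ?case using Suc assms(1) by simp
  qed simp
  then show ?thesis
    by (simp add: op_exp_def exp_def scaleR_conv_of_real divide_inverse mult.commute)
qed

text \<open>Only the all-zero configuration has \<open>Qz\<close> eigenvalue \<open>- J\<close>, so
  the lowest ket is a phase times the Dicke state. The raising relation then propagates the same
  phase up the ladder.\<close>

lemma top_multiplet_unique:
  assumes "top_multiplet n N ket"
  shows "\<exists>\<omega>. cmod \<omega> = 1 \<and> (\<forall>M\<in>mag_numbers (real n / 2 * real N). \<forall>x\<in>cfg n {..<N}.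
    ket M x = \<omega> * dicke n N M x)"
proof -
  define J where "J = real n / 2 * real N"
  define I where "I = cfg n {..<N}"
  have J2: "2 * J = real (n * N)" by (simp add: J_def)
  note ket = assms[unfolded top_multiplet_def Let_def, folded J_def I_def]
  note dk = dicke_top_multiplet[of n N, unfolded top_multiplet_def Let_def, folded J_def I_def]
  have mag: "real k - J \<in> mag_numbers J" if "k \<le> n * N" for k
  proof -
    have "real k \<le> real (n * N)" using that by (simp only: of_nat_le_iff)
    then show ?thesis using J2 unfolding mag_numbers_def by auto
  qed
  have low: "- J \<in> mag_numbers J" using mag[of 0] by simp
  define x0 :: "nat \<Rightarrow> nat" where "x0 = (\<lambda>i. if i < N then 0 else undefined)"
  have x0: "x0 \<in> I" by (auto simp: x0_def I_def cfg_def PiE_iff extensional_def)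
  have sum0: "x = x0" if "x \<in> I" "sum x {..<N} = 0" for x
    using that by (auto simp: x0_def I_def cfg_def PiE_iff extensional_def)
  have base: "ket (- J) x = 0" if "x \<in> I" "x \<noteq> x0" for x
  proof -
    have "of_real (real (sum x {..<N}) - J) * ket (- J) x = of_real (- J) * ket (- J) x"
      using ket low that op_apply_Qz[of x n N "ket (- J)"] by (simp add: I_def J_def)
    then have "complex_of_real (real (sum x {..<N})) * ket (- J) x = 0" by (simp add: algebra_simps)
    then show ?thesis using sum0[OF that(1)] that(2) by (auto simp del: of_nat_sum sum_eq_0_iff)
  qed
  have dicke_low: "dicke n N (- J) x = (if x = x0 then 1 else 0)" if "x \<in> I" for x
  proof (cases "x = x0")
    case True
    then show ?thesis by (simp add: dicke_def J_def x0_def dicke_weight_def)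
  next
    case False
    then have "sum x {..<N} \<noteq> 0" using sum0[OF that] by blast
    then show ?thesis using False by (simp add: dicke_def J_def del: of_nat_sum sum_eq_0_iff)
  qed
  define \<omega> where "\<omega> = ket (- J) x0"
  have fin: "finite I" by (simp add: I_def finite_cfg)
  have "inner_on I (ket (- J)) (ket (- J)) = (\<Sum>x\<in>I. if x = x0 then cnj \<omega> * \<omega> else 0)"
    unfolding inner_on_def by (intro sum.cong) (auto simp: base \<omega>_def)
  then have "cnj \<omega> * \<omega> = 1" using ket low x0 fin by simp
  then have "cmod \<omega> = 1"
    by (metis complex_mod_cnj norm_mult norm_one norm_ge_zero power2_eq_1_iff power2_eq_square
        abs_of_nonneg abs_square_eq_1)
  moreover have "ket (real k - J) x = \<omega> * dicke n N (real k - J) x"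
    if "k \<le> n * N" "x \<in> I" for k x
    using that
  proof (induction k arbitrary: x)
    case 0
    then show ?case using base[of x] dicke_low[of x] by (auto simp: \<omega>_def)
  next
    case (Suc k)
    define M where "M = real k - J"
    have M: "M \<in> mag_numbers J" using mag Suc.prems M_def by simp
    have M1: "real (Suc k) - J = M + 1" by (simp add: M_def)
    \<comment> \<open>The ladder coefficient vanishes only for \<open>M = J\<close> and
      \<open>M = - J - 1\<close>. Neither occurs below the top, so it can be cancelled.\<close>
    have "real (Suc k) \<le> real (n * N)" using Suc.prems by (simp only: of_nat_le_iff)
    then have "J \<noteq> M" "J + M + 1 \<noteq> 0" using J2 by (auto simp: M_def)
    then have nz: "sqrt ((J - M) * (J + M + 1)) \<noteq> 0" by simp
    have "of_real (sqrt ((J - M) * (J + M + 1))) * ket (M + 1) x = op_apply I (Qplus n N) (ket M) x"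
      using ket M Suc.prems by simp
    also have "\<dots> = \<omega> * op_apply I (Qplus n N) (dicke n N M) x"
      unfolding op_apply_def sum_distrib_left
      by (intro sum.cong) (use Suc in \<open>simp_all add: M_def mult_ac\<close>)
    also have "op_apply I (Qplus n N) (dicke n N M) x = of_real (sqrt ((J - M) * (J + M + 1))) * dicke n N (M + 1) x"
      using dk M Suc.prems by simp
    finally have "complex_of_real (sqrt ((J - M) * (J + M + 1))) * ket (M + 1) x
        = of_real (sqrt ((J - M) * (J + M + 1))) * (\<omega> * dicke n N (M + 1) x)"
      by (simp only: mult.left_commute)
    then show ?case using nz unfolding M1 by (simp only: mult_cancel_left of_real_eq_0_iff simp_thms)
  qed
  ultimately show ?thesis
    using mag_numbers_D[OF J_def[symmetric]] unfolding J_def[symmetric] I_def[symmetric] by blast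
qed

text \<open>The amplitude at total level \<open>k\<close> with \<open>dicke_weight\<close> split
  off. The levels \<open>K\<close> and \<open>n * N - K\<close> belong to \<open>|J, M>\<close> and
  \<open>|J, -M>\<close>; symmetry of the binomial coefficient gives them the same
  normalisation.\<close>

definition probe_amplitude :: "nat \<Rightarrow> nat \<Rightarrow> nat \<Rightarrow> real \<Rightarrow> nat \<Rightarrow> complex" where
  "probe_amplitude n N K \<theta> k = exp (- \<i> * of_real \<theta> * of_real (real k - real n / 2 * real N))
    * of_real (if k = K \<or> k = n * N - K then 1 / sqrt (2 * real (n * N choose K)) else 0)"

lemma cmod_probe_amplitude:
  "(cmod (probe_amplitude n N K \<theta> k))\<^sup>2
    = (if k = K \<or> k = n * N - K then 1 / (2 * real (n * N choose K)) else 0)"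
  by (auto simp: probe_amplitude_def norm_mult power_divide)

text \<open>The global phase of the multiplet cancels between ket and bra, and the rotation is a
  phase depending on the total level alone. The assumption \<open>n * N < 2 * K\<close> keeps the
  two levels distinct, so their amplitudes never add up.\<close>

lemma probe_state_entry:
  assumes top: "top_multiplet n N ket" and K: "K \<le> n * N" "n * N < 2 * K"
    and xy: "x \<in> cfg n {..<N}" "y \<in> cfg n {..<N}"
  shows "probe_state n N ket (real K - real n / 2 * real N) \<theta> x y
    = of_real (dicke_weight n N x) * probe_amplitude n N K \<theta> (sum x {..<N})
      * cnj (of_real (dicke_weight n N y) * probe_amplitude n N K \<theta> (sum y {..<N}))"
proof -
  define J where "J = real n / 2 * real N"
  define I where "I = cfg n {..<N}"
  define M where "M = real K - J"
  define U where "U = op_exp I (\<lambda>x y. - \<i> * of_real \<theta> * Qz n N x y)"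
  have J2: "2 * J = real (n * N)" by (simp add: J_def)
  have fin: "finite I" by (simp add: I_def finite_cfg)
  obtain \<omega> where \<omega>: "cmod \<omega> = 1"
    "\<And>M x. M \<in> mag_numbers J \<Longrightarrow> x \<in> I \<Longrightarrow> ket M x = \<omega> * dicke n N M x"
    using top_multiplet_unique[OF top] unfolding J_def I_def by blast
  have K': "real (n * N - K) = real (n * N) - real K" "real K \<le> real (n * N)"
    using K(1) by (simp only: of_nat_diff, simp only: of_nat_le_iff)
  have "M = real K - J \<and> M \<le> J" "- M = real (n * N - K) - J \<and> - M \<le> J"
    using J2 K' M_def by linarith+
  then have mag: "M \<in> mag_numbers J" "- M \<in> mag_numbers J"
    unfolding mag_numbers_def mem_Collect_eq by blast+
  have U: "op_apply I U u x = exp (- \<i> * of_real \<theta> * of_real (real (sum x {..<N}) - J)) * u x"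
    if x: "x \<in> I" for u x
  proof -
    have "op_apply I U u x
        = (\<Sum>y\<in>I. if y = x then exp (- \<i> * of_real \<theta> * of_real (real (sum x {..<N}) - J)) * u x else 0)"
      unfolding op_apply_def
    proof (intro sum.cong refl)
      fix y assume y: "y \<in> I"
      have "U x y = (if x = y then exp (- \<i> * of_real \<theta> * of_real (real (sum x {..<N}) - J)) else 0)"
        unfolding U_def by (rule op_exp_diagonal[OF fin _ x y]) (simp add: Qz_entry I_def J_def)
      then show "U x y * u y = (if y = x then exp (- \<i> * of_real \<theta> * of_real (real (sum x {..<N}) - J)) * u x else 0)"
        by simp
    qed
    then show ?thesis using x fin by simp
  qed
  have choose: "(n * N choose (n * N - K)) = (n * N choose K)"
    using binomial_symmetric[OF K(1)] by simp
  then have choose': "(N * n choose (N * n - K)) = (N * n choose K)" by (simp only: mult.commute)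
  have pk: "probe_ket ket M x = \<omega> * of_real (dicke_weight n N x)
      * of_real (if sum x {..<N} = K \<or> sum x {..<N} = n * N - K then 1 / sqrt (2 * real (n * N choose K)) else 0)"
    if x: "x \<in> I" for x
  proof -
    have "real (sum x {..<N}) = M + J \<longleftrightarrow> sum x {..<N} = K" by (simp add: M_def del: of_nat_sum)
    moreover have "real (sum x {..<N}) = - M + J \<longleftrightarrow> sum x {..<N} = n * N - K"
      using J2 K' M_def by (metis (no_types, opaque_lifting) of_nat_eq_iff add_diff_eq diff_add_eq minus_diff_eq mult_2 uminus_add_conv_diff)
    moreover have "K \<noteq> n * N - K" using K by linarith
    ultimately show ?thesis
      unfolding probe_ket_def \<omega>(2)[OF mag(1) x] \<omega>(2)[OF mag(2) x] dicke_def J_def[symmetric]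
      by (auto simp: choose choose' real_sqrt_mult field_simps simp del: of_nat_sum)
  qed
  have amp: "op_apply I U (probe_ket ket M) x
      = \<omega> * (of_real (dicke_weight n N x) * probe_amplitude n N K \<theta> (sum x {..<N}))" if "x \<in> I" for x
    unfolding U[OF that] pk[OF that] probe_amplitude_def J_def[symmetric] by (simp only: mult_ac)
  have one: "\<omega> * cnj \<omega> = 1" using \<omega>(1) by (simp add: complex_norm_square[symmetric])
  have "probe_state n N ket M \<theta> x y = op_apply I U (probe_ket ket M) x * cnj (op_apply I U (probe_ket ket M) y)"
    by (simp add: probe_state_def Let_def ket_bra_def U_def I_def)
  also have "\<dots> = (\<omega> * cnj \<omega>) * (of_real (dicke_weight n N x) * probe_amplitude n N K \<theta> (sum x {..<N})
      * cnj (of_real (dicke_weight n N y) * probe_amplitude n N K \<theta> (sum y {..<N})))"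
    using xy amp unfolding I_def by (simp add: mult_ac)
  finally show ?thesis unfolding one by (simp add: M_def J_def)
qed

lemma probe_deriv_entry:
  assumes "x \<in> cfg n {..<N}" "y \<in> cfg n {..<N}"
  shows "probe_deriv n N ket M \<theta> x y
    = - \<i> * of_real (real (sum x {..<N}) - real (sum y {..<N})) * probe_state n N ket M \<theta> x y"
proof -
  define I where "I = cfg n {..<N}"
  define \<psi> where "\<psi> = probe_state n N ket M \<theta>"
  have fin: "finite I" by (simp add: I_def finite_cfg)
  have "op_mult I (Qz n N) \<psi> x y = op_apply I (Qz n N) (\<lambda>z. \<psi> z y) x"
    by (simp add: op_mult_def op_apply_def)
  then have 1: "op_mult I (Qz n N) \<psi> x y = of_real (real (sum x {..<N}) - real n / 2 * real N) * \<psi> x y"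
    using op_apply_Qz[OF assms(1)] by (simp add: I_def)
  have "op_mult I \<psi> (Qz n N) x y
      = (\<Sum>z\<in>I. if z = y then \<psi> x y * of_real (real (sum y {..<N}) - real n / 2 * real N) else 0)"
    unfolding op_mult_def using assms by (intro sum.cong refl) (auto simp: I_def Qz_entry)
  then have 2: "op_mult I \<psi> (Qz n N) x y = \<psi> x y * of_real (real (sum y {..<N}) - real n / 2 * real N)"
    using fin assms by (simp add: I_def)
  show ?thesis
    unfolding probe_deriv_def op_commutator_def I_def[symmetric] \<psi>_def[symmetric] 1 2
    by (simp add: algebra_simps)
qed

section \<open>The erased probe state\<close>

text \<open>Generalises \<open>dicke_weight\<close> to any set of sites, so that it factorises over
  lost and surviving sites.\<close>

definition site_weight :: "nat \<Rightarrow> nat set \<Rightarrow> (nat \<Rightarrow> nat) \<Rightarrow> real" where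
  "site_weight n S x = (\<Prod>i\<in>S. sqrt (real (n choose x i)))"

text \<open>The squared weights are products of binomials, so grouping by total level leaves a
  Vandermonde sum. The type of \<open>f\<close> covers both complex matrix entries and real
  norms.\<close>

lemma sum_cfg_by_level:
  fixes f :: "nat \<Rightarrow> 'a :: {real_algebra_1, comm_ring_1}"
  assumes "finite S"
  shows "(\<Sum>z\<in>cfg n S. of_real ((site_weight n S z)\<^sup>2) * f (sum z S))
    = (\<Sum>l\<le>n * card S. of_nat (n * card S choose l) * f l)"
proof -
  have fin: "finite (cfg n S)" by (rule finite_cfg[OF assms])
  have le: "sum z S \<le> n * card S" if "z \<in> cfg n S" for z
    using that sum_bounded_above[of S z n] by (auto simp: cfg_def PiE_iff mult.commute)
  have sq: "(site_weight n S z)\<^sup>2 = real (\<Prod>i\<in>S. n choose z i)" for z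
    by (simp add: site_weight_def prod_power_distrib)
  have "(\<Sum>z\<in>cfg n S. of_real ((site_weight n S z)\<^sup>2) * f (sum z S))
      = (\<Sum>l\<le>n * card S. \<Sum>z\<in>{z \<in> cfg n S. sum z S = l}. of_real ((site_weight n S z)\<^sup>2) * f (sum z S))"
    using fin le by (intro sum.group[symmetric]) auto
  also have "\<dots> = (\<Sum>l\<le>n * card S. of_nat (\<Sum>z\<in>{z \<in> cfg n S. sum z S = l}. \<Prod>i\<in>S. n choose z i) * f l)"
    unfolding of_nat_sum sum_distrib_right sq by (intro sum.cong refl) (simp del: of_nat_prod)
  finally show ?thesis by (simp only: vandermonde_cfg[OF assms])
qed

lemma override_on_cfg:
  assumes "x \<in> cfg n (S - \<alpha>)" "z \<in> cfg n \<alpha>" "\<alpha> \<subseteq> S" "finite S"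
  shows "override_on x z \<alpha> \<in> cfg n S"
    and "sum (override_on x z \<alpha>) S = sum x (S - \<alpha>) + sum z \<alpha>"
    and "site_weight n S (override_on x z \<alpha>) = site_weight n (S - \<alpha>) x * site_weight n \<alpha> z"
proof -
  show "override_on x z \<alpha> \<in> cfg n S"
    using assms by (auto simp: cfg_def PiE_iff extensional_def override_on_def)
  show "sum (override_on x z \<alpha>) S = sum x (S - \<alpha>) + sum z \<alpha>"
    unfolding sum.subset_diff[OF assms(3,4)]
    by (intro arg_cong2[where f = "(+)"] sum.cong) (auto simp: override_on_def)
  show "site_weight n S (override_on x z \<alpha>) = site_weight n (S - \<alpha>) x * site_weight n \<alpha> z"
    unfolding site_weight_def prod.subset_diff[OF assms(3,4)]
    by (intro arg_cong2[where f = "(*)"] prod.cong) (auto simp: override_on_def)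
qed

text \<open>
  The component \<open>(\<alpha>, l)\<close> belongs to the lost set \<open>\<alpha>\<close> and the level \<open>l\<close> (the sum of the site levels)
  carried away by the lost sites.
\<close>

definition erased_component ::
  "nat \<Rightarrow> nat \<Rightarrow> nat \<Rightarrow> (nat set \<Rightarrow> real) \<Rightarrow> real \<Rightarrow> nat set \<times> nat \<Rightarrow> (nat set \<times> (nat \<Rightarrow> nat)) ket" where
  "erased_component n N K p \<theta> = (\<lambda>(\<alpha>, l) (\<beta>, x). if \<alpha> = \<beta> then
     of_real (sqrt (p \<alpha> * real (n * card \<alpha> choose l)) * site_weight n ({..<N} - \<alpha>) x)
       * probe_amplitude n N K \<theta> (sum x ({..<N} - \<alpha>) + l) else 0)"

lemma lost_plus_surviving_levels:
  assumes "\<alpha> \<subseteq> {..<N}"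
  shows "n * card \<alpha> + n * card ({..<N} - \<alpha>) = n * N"
proof -
  have "card \<alpha> + card ({..<N} - \<alpha>) = N"
    using assms
    by (metis card_Diff_subset card_lessThan card_mono finite_lessThan finite_subset le_add_diff_inverse)
  then show ?thesis by (metis distrib_left)
qed

lemma finite_erasure_sets: "finite (erasure_sets N d)"
  by (rule finite_subset[of _ "Pow {..<N}"]) (auto simp: erasure_sets_def)

text \<open>Weights factorise and levels add over lost and surviving sites, so a lost configuration
  matters only through its level. The function \<open>f\<close> is kept general to serve both the
  state and its derivative.\<close>

lemma partial_trace_entries:
  assumes \<alpha>: "\<alpha> \<subseteq> {..<N}" and xy: "x \<in> cfg n ({..<N} - \<alpha>)" "y \<in> cfg n ({..<N} - \<alpha>)"
    and \<rho>: "\<And>x y. x \<in> cfg n {..<N} \<Longrightarrow> y \<in> cfg n {..<N} \<Longrightarrow>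
      \<rho> x y = of_real (site_weight n {..<N} x) * of_real (site_weight n {..<N} y)
        * f (sum x {..<N}) (sum y {..<N})"
  shows "partial_trace n \<alpha> \<rho> x y
    = (\<Sum>l\<le>n * card \<alpha>. of_nat (n * card \<alpha> choose l)
        * (of_real (site_weight n ({..<N} - \<alpha>) x) * of_real (site_weight n ({..<N} - \<alpha>) y)
          * f (sum x ({..<N} - \<alpha>) + l) (sum y ({..<N} - \<alpha>) + l)))"
proof -
  have fin: "finite \<alpha>" using \<alpha> finite_subset by blast
  have "partial_trace n \<alpha> \<rho> x y
      = (\<Sum>z\<in>cfg n \<alpha>. of_real ((site_weight n \<alpha> z)\<^sup>2)
        * (of_real (site_weight n ({..<N} - \<alpha>) x) * of_real (site_weight n ({..<N} - \<alpha>) y)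
          * f (sum x ({..<N} - \<alpha>) + sum z \<alpha>) (sum y ({..<N} - \<alpha>) + sum z \<alpha>)))"
    unfolding partial_trace_def
  proof (rule sum.cong[OF refl])
    fix z assume z: "z \<in> cfg n \<alpha>"
    note x = override_on_cfg[OF xy(1) z \<alpha> finite_lessThan]
    note y = override_on_cfg[OF xy(2) z \<alpha> finite_lessThan]
    show "\<rho> (override_on x z \<alpha>) (override_on y z \<alpha>) = of_real ((site_weight n \<alpha> z)\<^sup>2)
        * (of_real (site_weight n ({..<N} - \<alpha>) x) * of_real (site_weight n ({..<N} - \<alpha>) y)
          * f (sum x ({..<N} - \<alpha>) + sum z \<alpha>) (sum y ({..<N} - \<alpha>) + sum z \<alpha>))"
      unfolding \<rho>[OF x(1) y(1)] x(2,3) y(2,3) by (simp add: power2_eq_square mult_ac)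
  qed
  then show ?thesis
    by (simp only: sum_cfg_by_level[OF fin, where f = "\<lambda>k. of_real (site_weight n ({..<N} - \<alpha>) x)
      * of_real (site_weight n ({..<N} - \<alpha>) y)
      * f (sum x ({..<N} - \<alpha>) + k) (sum y ({..<N} - \<alpha>) + k)"])
qed

text \<open>The lost level \<open>l\<close> is common to row and column and cancels in the
  difference of total levels. Hence erasure preserves the commutator form of the derivative, with
  \<open>g\<close> measuring the surviving level only.\<close>

lemma erase_probe_entries:
  assumes top: "top_multiplet n N ket" and K: "K \<le> n * N" "n * N < 2 * K"
    and p: "\<And>\<alpha>. \<alpha> \<in> erasure_sets N d \<Longrightarrow> 0 \<le> p \<alpha>"
    and \<xi>: "\<xi> \<in> erased_space n N d" "\<eta> \<in> erased_space n N d"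
  defines "M \<equiv> real K - real n / 2 * real N"
    and "g \<equiv> \<lambda>(\<alpha>, x). real (sum x ({..<N} - \<alpha>))"
  shows "erase n p (probe_state n N ket M \<theta>) \<xi> \<eta>
      = (\<Sum>j\<in>(SIGMA \<alpha>:erasure_sets N d. {..n * card \<alpha>}).
          erased_component n N K p \<theta> j \<xi> * cnj (erased_component n N K p \<theta> j \<eta>))"
    and "erase n p (probe_deriv n N ket M \<theta>) \<xi> \<eta>
      = - \<i> * of_real (g \<xi> - g \<eta>) * erase n p (probe_state n N ket M \<theta>) \<xi> \<eta>"
proof -
  obtain \<alpha> x \<beta> y where \<xi>\<eta>: "\<xi> = (\<alpha>, x)" "\<eta> = (\<beta>, y)" by fastforce
  have \<alpha>: "\<alpha> \<in> erasure_sets N d" "\<alpha> \<subseteq> {..<N}" "x \<in> cfg n ({..<N} - \<alpha>)"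
    using \<xi> by (auto simp: \<xi>\<eta> erased_space_def erasure_sets_def)
  let ?w = "site_weight n" and ?a = "probe_amplitude n N K \<theta>" and ?S = "{..<N} - \<alpha>"
  let ?v = "erased_component n N K p \<theta>"
  have state: "probe_state n N ket M \<theta> u u' = of_real (?w {..<N} u) * of_real (?w {..<N} u')
      * (?a (sum u {..<N}) * cnj (?a (sum u' {..<N})))"
    if "u \<in> cfg n {..<N}" "u' \<in> cfg n {..<N}" for u u'
    unfolding M_def probe_state_entry[OF top K that] dicke_weight_def site_weight_def
    by (simp add: mult_ac)
  have deriv: "probe_deriv n N ket M \<theta> u u' = of_real (?w {..<N} u) * of_real (?w {..<N} u')
      * (- \<i> * of_real (real (sum u {..<N}) - real (sum u' {..<N})) * (?a (sum u {..<N}) * cnj (?a (sum u' {..<N}))))"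
    if "u \<in> cfg n {..<N}" "u' \<in> cfg n {..<N}" for u u'
    unfolding probe_deriv_entry[OF that] state[OF that] by (simp only: mult_ac)
  have sum_v: "(\<Sum>j\<in>(SIGMA \<alpha>:erasure_sets N d. {..n * card \<alpha>}). ?v j \<xi> * cnj (?v j \<eta>))
      = (\<Sum>l\<le>n * card \<alpha>. ?v (\<alpha>, l) \<xi> * cnj (?v (\<alpha>, l) \<eta>))"
  proof -
    have "(\<Sum>j\<in>(SIGMA \<alpha>:erasure_sets N d. {..n * card \<alpha>}). ?v j \<xi> * cnj (?v j \<eta>))
      = (\<Sum>\<gamma>\<in>erasure_sets N d. \<Sum>l\<le>n * card \<gamma>. ?v (\<gamma>, l) \<xi> * cnj (?v (\<gamma>, l) \<eta>))"
      by (subst sum.Sigma) (auto simp: finite_erasure_sets)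
    also have "\<dots> = (\<Sum>\<gamma>\<in>erasure_sets N d. if \<gamma> = \<alpha> then \<Sum>l\<le>n * card \<alpha>. ?v (\<alpha>, l) \<xi> * cnj (?v (\<alpha>, l) \<eta>) else 0)"
      by (intro sum.cong refl) (auto simp: erased_component_def \<xi>\<eta>)
    finally show ?thesis using \<alpha>(1) finite_erasure_sets by simp
  qed
  have both: "erase n p (probe_state n N ket M \<theta>) \<xi> \<eta>
      = (\<Sum>j\<in>(SIGMA \<alpha>:erasure_sets N d. {..n * card \<alpha>}). ?v j \<xi> * cnj (?v j \<eta>))
    \<and> erase n p (probe_deriv n N ket M \<theta>) \<xi> \<eta>
      = - \<i> * of_real (g \<xi> - g \<eta>) * erase n p (probe_state n N ket M \<theta>) \<xi> \<eta>"
  proof (cases "\<alpha> = \<beta>")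
    case False
    then show ?thesis unfolding sum_v by (simp add: \<xi>\<eta> erase_def erased_component_def)
  next
    case True
    then have y: "y \<in> cfg n ?S" using \<xi>(2) by (auto simp: \<xi>\<eta> erased_space_def)
    have tr_state: "partial_trace n \<alpha> (probe_state n N ket M \<theta>) x y
      = (\<Sum>l\<le>n * card \<alpha>. of_nat (n * card \<alpha> choose l) * (of_real (?w ?S x) * of_real (?w ?S y)
          * (?a (sum x ?S + l) * cnj (?a (sum y ?S + l)))))"
      by (rule partial_trace_entries[OF \<alpha>(2,3) y, where f = "\<lambda>k k'. ?a k * cnj (?a k')"]; rule state)
    have tr_deriv: "partial_trace n \<alpha> (probe_deriv n N ket M \<theta>) x y
      = (\<Sum>l\<le>n * card \<alpha>. of_nat (n * card \<alpha> choose l) * (of_real (?w ?S x) * of_real (?w ?S y)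
          * (- \<i> * of_real (real (sum x ?S + l) - real (sum y ?S + l)) * (?a (sum x ?S + l) * cnj (?a (sum y ?S + l))))))"
      by (rule partial_trace_entries[OF \<alpha>(2,3) y,
            where f = "\<lambda>k k'. - \<i> * of_real (real k - real k') * (?a k * cnj (?a k'))"]; rule deriv)
    have "?v (\<alpha>, l) \<xi> * cnj (?v (\<alpha>, l) \<eta>) = of_real (p \<alpha>) * (of_nat (n * card \<alpha> choose l)
        * (of_real (?w ?S x) * of_real (?w ?S y) * (?a (sum x ?S + l) * cnj (?a (sum y ?S + l)))))" for l
    proof -
      define r where "r = sqrt (p \<alpha> * real (n * card \<alpha> choose l))"
      have r: "complex_of_real r * of_real r = of_real (p \<alpha>) * of_nat (n * card \<alpha> choose l)"
        unfolding of_real_mult[symmetric] r_def real_sqrt_mult_self using p[OF \<alpha>(1)] by simp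
      have "?v (\<alpha>, l) \<xi> * cnj (?v (\<alpha>, l) \<eta>) = (complex_of_real r * of_real r)
          * (of_real (?w ?S x) * of_real (?w ?S y) * (?a (sum x ?S + l) * cnj (?a (sum y ?S + l))))"
        unfolding \<xi>\<eta> True[symmetric] erased_component_def prod.case r_def[symmetric] by simp
      then show ?thesis unfolding r by (simp only: mult.assoc)
    qed
    then have v: "(\<Sum>l\<le>n * card \<alpha>. ?v (\<alpha>, l) \<xi> * cnj (?v (\<alpha>, l) \<eta>))
        = of_real (p \<alpha>) * partial_trace n \<alpha> (probe_state n N ket M \<theta>) x y"
      unfolding tr_state sum_distrib_left by (rule sum.cong[OF refl])
    have "partial_trace n \<alpha> (probe_deriv n N ket M \<theta>) x y
        = - \<i> * of_real (g \<xi> - g \<eta>) * partial_trace n \<alpha> (probe_state n N ket M \<theta>) x y"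
      unfolding tr_state tr_deriv sum_distrib_left
    proof (rule sum.cong[OF refl])
      fix l
      have "real (sum x ?S + l) - real (sum y ?S + l) = g \<xi> - g \<eta>"
        using True by (simp add: g_def \<xi>\<eta>)
      then show "of_nat (n * card \<alpha> choose l) * (of_real (?w ?S x) * of_real (?w ?S y)
          * (- \<i> * of_real (real (sum x ?S + l) - real (sum y ?S + l)) * (?a (sum x ?S + l) * cnj (?a (sum y ?S + l)))))
        = - \<i> * of_real (g \<xi> - g \<eta>) * (of_nat (n * card \<alpha> choose l)
          * (of_real (?w ?S x) * of_real (?w ?S y) * (?a (sum x ?S + l) * cnj (?a (sum y ?S + l)))))"
        by (simp only: mult_ac)
    qed
    moreover have "erase n p \<rho> \<xi> \<eta> = of_real (p \<alpha>) * partial_trace n \<alpha> \<rho> x y" for \<rho>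
      using True by (simp add: \<xi>\<eta> erase_def)
    ultimately show ?thesis unfolding sum_v v by (simp only: mult_ac)
  qed
  then show "erase n p (probe_state n N ket M \<theta>) \<xi> \<eta>
      = (\<Sum>j\<in>(SIGMA \<alpha>:erasure_sets N d. {..n * card \<alpha>}). ?v j \<xi> * cnj (?v j \<eta>))"
    and "erase n p (probe_deriv n N ket M \<theta>) \<xi> \<eta>
      = - \<i> * of_real (g \<xi> - g \<eta>) * erase n p (probe_state n N ket M \<theta>) \<xi> \<eta>"
    by blast+
qed

text \<open>After the loss of level \<open>l\<close> only the surviving levels \<open>K - l\<close>
  and \<open>K' - l\<close> carry amplitude. Taking \<open>F\<close> constant gives the norm of the
  component; squared level differences give the numerator of the Fisher information.\<close>

lemma erased_component_level_sum:
  assumes p: "0 \<le> p \<alpha>" and \<alpha>: "\<alpha> \<in> erasure_sets N d"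
    and K: "n * N < 2 * K" and l: "l \<le> n * N - K"
  defines "m \<equiv> n * card ({..<N} - \<alpha>)" and "K' \<equiv> n * N - K"
    and "c \<equiv> p \<alpha> * real (n * card \<alpha> choose l) / (2 * real (n * N choose K))"
  shows "(\<Sum>\<xi>\<in>erased_space n N d. (cmod (erased_component n N K p \<theta> (\<alpha>, l) \<xi>))\<^sup>2
        * F (sum (snd \<xi>) ({..<N} - fst \<xi>)))
    = c * real (m choose (K - l)) * F (K - l) + c * real (m choose (K' - l)) * F (K' - l)"
proof -
  let ?S = "{..<N} - \<alpha>" and ?Q = "\<lambda>\<xi>. (cmod (erased_component n N K p \<theta> (\<alpha>, l) \<xi>))\<^sup>2"
  define s where "s = p \<alpha> * real (n * card \<alpha> choose l)"
  define a where "a k = (if k = K \<or> k = K' then 1 / (2 * real (n * N choose K)) else 0)" for k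
  have Q: "?Q (\<alpha>, x) = s * (site_weight n ?S x)\<^sup>2 * a (sum x ?S + l)" for x
  proof -
    have "(sqrt s)\<^sup>2 = s" using p by (simp add: s_def)
    then show ?thesis
      unfolding erased_component_def prod.case if_P[OF refl] norm_mult power_mult_distrib
        cmod_probe_amplitude s_def[symmetric] norm_of_real power2_abs a_def K'_def by simp
  qed
  have Kl: "K \<noteq> K'" "l \<le> K" "l \<le> K'" using K l by (auto simp: K'_def)
  have "(\<Sum>\<xi>\<in>erased_space n N d. ?Q \<xi> * F (sum (snd \<xi>) ({..<N} - fst \<xi>)))
      = (\<Sum>\<beta>\<in>erasure_sets N d. \<Sum>x\<in>cfg n ({..<N} - \<beta>). ?Q (\<beta>, x) * F (sum x ({..<N} - \<beta>)))"
    unfolding erased_space_def by (subst sum.Sigma) (auto simp: finite_erasure_sets finite_cfg split_def)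
  also have "\<dots> = (\<Sum>\<beta>\<in>erasure_sets N d. if \<beta> = \<alpha> then \<Sum>x\<in>cfg n ?S. ?Q (\<alpha>, x) * F (sum x ?S) else 0)"
    by (intro sum.cong refl) (auto simp: erased_component_def)
  also have "\<dots> = (\<Sum>x\<in>cfg n ?S. of_real ((site_weight n ?S x)\<^sup>2) * (s * a (sum x ?S + l) * F (sum x ?S)))"
    using \<alpha> by (simp add: finite_erasure_sets Q mult_ac)
  also have "\<dots> = (\<Sum>k\<le>m. real (m choose k) * (s * a (k + l) * F k))"
    unfolding m_def by (rule sum_cfg_by_level[where f = "\<lambda>k. s * a (k + l) * F k"]) simp
  also have "\<dots> = (\<Sum>k\<le>m. (if k = K - l then c * real (m choose (K - l)) * F (K - l) else 0)
      + (if k = K' - l then c * real (m choose (K' - l)) * F (K' - l) else 0))"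
  proof (rule sum.cong[OF refl])
    fix k
    have "k + l = K \<longleftrightarrow> k = K - l" "k + l = K' \<longleftrightarrow> k = K' - l" "K - l \<noteq> K' - l"
      using Kl by linarith+
    then show "real (m choose k) * (s * a (k + l) * F k) = (if k = K - l then c * real (m choose (K - l)) * F (K - l) else 0)
      + (if k = K' - l then c * real (m choose (K' - l)) * F (K' - l) else 0)"
      unfolding a_def by (auto simp: c_def s_def)
  qed
  \<comment> \<open>A level above \<open>m\<close> is missing from the range of summation, but its
    binomial coefficient is 0 as well.\<close>
  also have "\<dots> = c * real (m choose (K - l)) * F (K - l) + c * real (m choose (K' - l)) * F (K' - l)"
    by (simp add: sum.distrib binomial_eq_0)
  finally show ?thesis .
qed

text \<open>Each block is a two-level system with weights \<open>P\<close> and \<open>P'\<close> and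
  level distance \<open>D\<close>, contributing
  \<open>4 * D\<^sup>2 * P * P' / (P + P')\<close>.\<close>

lemma qfi_erased_probe:
  assumes top: "top_multiplet n N ket" and K: "K \<le> n * N"
    and D: "2 * K = n * N + D" "n * d < D" and dK: "n * d \<le> n * N - K"
    and p: "erasure_dist N d p"
  defines "M \<equiv> real K - real n / 2 * real N"
  shows "\<exists>R. is_SLD (erased_space n N d) (erase n p (probe_state n N ket M \<theta>)) (erase n p (probe_deriv n N ket M \<theta>)) R"
    and "qfi (erased_space n N d) (erase n p (probe_state n N ket M \<theta>)) (erase n p (probe_deriv n N ket M \<theta>))
      = (\<Sum>\<alpha>\<in>erasure_sets N d. p \<alpha> * (2 * (real D)\<^sup>2 * (\<Sum>l\<le>n * card \<alpha>.
          hypergeom (n * card \<alpha>) (n * card ({..<N} - \<alpha>)) K l * hypergeom (n * card \<alpha>) (n * card ({..<N} - \<alpha>)) (K - D) l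
          / (hypergeom (n * card \<alpha>) (n * card ({..<N} - \<alpha>)) K l
             + hypergeom (n * card \<alpha>) (n * card ({..<N} - \<alpha>)) (K - D) l))))"
proof -
  let ?H = "erased_space n N d" and ?v = "erased_component n N K p \<theta>"
  let ?L = "SIGMA \<alpha>:erasure_sets N d. {..n * card \<alpha>}"
  define g where "g = (\<lambda>(\<alpha>, x). real (sum x ({..<N} - \<alpha>)))"
  have K2: "n * N < 2 * K" "K - D = n * N - K" using D K by linarith+
  have p0: "0 \<le> p \<alpha>" if "\<alpha> \<in> erasure_sets N d" for \<alpha> using p that by (simp add: erasure_dist_def)
  have card: "n * card \<alpha> \<le> n * d" if "\<alpha> \<in> erasure_sets N d" for \<alpha>
    using that by (simp add: erasure_sets_def)
  have fin: "finite ?H" "finite ?L"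
    unfolding erased_space_def by (auto intro!: finite_SigmaI simp: finite_erasure_sets finite_cfg)
  \<comment> \<open>Two blocks with the same lost set can share a configuration only if their lost
    levels differ by 0 or by \<open>D\<close>; both levels are below \<open>D\<close>.\<close>
  have disj: "?v j \<xi> = 0 \<or> ?v j' \<xi> = 0" if j: "j \<in> ?L" "j' \<in> ?L" "j \<noteq> j'" for j j' \<xi>
  proof -
    obtain \<alpha> l \<alpha>' l' \<beta> x where eqs: "j = (\<alpha>, l)" "j' = (\<alpha>', l')" "\<xi> = (\<beta>, x)"
      by (metis surj_pair)
    show ?thesis
    proof (cases "\<alpha> = \<beta> \<and> \<alpha>' = \<beta>")
      case True
      then have "l \<noteq> l'" "l \<le> n * card \<beta>" "l' \<le> n * card \<beta>" "n * card \<beta> \<le> n * d"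
        using j card[of \<beta>] by (auto simp: eqs)
      then have ll: "l \<noteq> l'" "l < D" "l' < D" using D(2) by linarith+
      let ?k = "sum x ({..<N} - \<beta>)"
      have "\<not> (?k + l = K \<or> ?k + l = n * N - K) \<or> \<not> (?k + l' = K \<or> ?k + l' = n * N - K)"
        using ll D(1) K by linarith
      then show ?thesis by (auto simp: eqs erased_component_def probe_amplitude_def)
    qed (auto simp: eqs erased_component_def)
  qed
  note entries = erase_probe_entries[OF top K K2(1) p0, folded M_def g_def]
  note qfi = qfi_disjoint_supports[where I = ?H and L = ?L and v = ?v and g = g
      and \<rho> = "erase n p (probe_state n N ket M \<theta>)" and d\<rho> = "erase n p (probe_deriv n N ket M \<theta>)",
      OF fin disj entries]
  show "\<exists>R. is_SLD ?H (erase n p (probe_state n N ket M \<theta>)) (erase n p (probe_deriv n N ket M \<theta>)) R"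
    by (rule qfi(1))
  have block: "2 * (\<Sum>\<xi>\<in>?H. \<Sum>\<eta>\<in>?H. (g \<xi> - g \<eta>)\<^sup>2 * (cmod (?v (\<alpha>, l) \<xi>))\<^sup>2 * (cmod (?v (\<alpha>, l) \<eta>))\<^sup>2)
      / (\<Sum>\<xi>\<in>?H. (cmod (?v (\<alpha>, l) \<xi>))\<^sup>2) = p \<alpha> * (2 * (real D)\<^sup>2 * (A * B / (A + B)))"
    if \<alpha>: "\<alpha> \<in> erasure_sets N d" and l: "l \<le> n * card \<alpha>"
      and A: "A = hypergeom (n * card \<alpha>) (n * card ({..<N} - \<alpha>)) K l"
      and B: "B = hypergeom (n * card \<alpha>) (n * card ({..<N} - \<alpha>)) (K - D) l" for \<alpha> l A B
  proof -
    have lK: "l \<le> n * N - K" using l card[OF \<alpha>] dK by linarith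
    have nN: "n * card \<alpha> + n * card ({..<N} - \<alpha>) = n * N"
      using \<alpha> by (intro lost_plus_surviving_levels) (simp add: erasure_sets_def)
    have C: "(n * N choose (n * N - K)) = (n * N choose K)" using binomial_symmetric[OF K] by simp
    note level = erased_component_level_sum[where n = n and N = N and d = d and p = p and \<theta> = \<theta> and K = K, OF p0[OF \<alpha>] \<alpha> K2(1) lK]
    define P where "P = p \<alpha> * A / 2"
    define P' where "P' = p \<alpha> * B / 2"
    have PP: "p \<alpha> * real (n * card \<alpha> choose l) / (2 * real (n * N choose K)) * real (n * card ({..<N} - \<alpha>) choose (K - l)) = P"
      "p \<alpha> * real (n * card \<alpha> choose l) / (2 * real (n * N choose K)) * real (n * card ({..<N} - \<alpha>) choose (n * N - K - l)) = P'"
      unfolding P_def P'_def A B hypergeom_def nN K2(2) C by simp_all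
    have "(\<Sum>\<xi>\<in>?H. (cmod (?v (\<alpha>, l) \<xi>))\<^sup>2) = P + P'"
      using level[of "\<lambda>_. 1"] by (simp only: PP mult_1_right)
    moreover have "(\<Sum>\<xi>\<in>?H. \<Sum>\<eta>\<in>?H. (g \<xi> - g \<eta>)\<^sup>2 * (cmod (?v (\<alpha>, l) \<xi>))\<^sup>2 * (cmod (?v (\<alpha>, l) \<eta>))\<^sup>2)
        = 2 * (real D)\<^sup>2 * P * P'"
    proof -
      have g: "g \<xi> = real (sum (snd \<xi>) ({..<N} - fst \<xi>))" for \<xi> by (simp add: g_def split_def)
      \<comment> \<open>\<open>level\<close> is used twice: for the inner sum at a fixed
        \<open>k\<close>, giving \<open>?G\<close>, and then for the outer sum of \<open>?G\<close>.
        Only the two cross terms survive.\<close>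
      let ?G = "\<lambda>k. P * (k - real (K - l))\<^sup>2 + P' * (k - real (n * N - K - l))\<^sup>2"
      have inner: "(\<Sum>\<eta>\<in>?H. (cmod (?v (\<alpha>, l) \<eta>))\<^sup>2 * (k - real (sum (snd \<eta>) ({..<N} - fst \<eta>)))\<^sup>2) = ?G k" for k
        using level[of "\<lambda>k'. (k - real k')\<^sup>2"] by (simp only: PP)
      have "(\<Sum>\<xi>\<in>?H. \<Sum>\<eta>\<in>?H. (g \<xi> - g \<eta>)\<^sup>2 * (cmod (?v (\<alpha>, l) \<xi>))\<^sup>2 * (cmod (?v (\<alpha>, l) \<eta>))\<^sup>2)
          = (\<Sum>\<xi>\<in>?H. (cmod (?v (\<alpha>, l) \<xi>))\<^sup>2 * ?G (real (sum (snd \<xi>) ({..<N} - fst \<xi>))))"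
        unfolding inner[symmetric] sum_distrib_left g by (intro sum.cong refl) (simp only: mult_ac)
      also have "\<dots> = P * ?G (real (K - l)) + P' * ?G (real (n * N - K - l))"
        using level[of "\<lambda>k. ?G (real k)"] by (simp only: PP)
      also have "\<dots> = 2 * (real D)\<^sup>2 * P * P'"
      proof -
        have "K - l = n * N - K - l + D" using lK D(1) K by linarith
        then have "real (K - l) - real (n * N - K - l) = real D" by simp
        then have "(real (K - l) - real (n * N - K - l))\<^sup>2 = (real D)\<^sup>2" "(real (n * N - K - l) - real (K - l))\<^sup>2 = (real D)\<^sup>2"
          by (simp_all add: power2_commute)
        then show ?thesis by simp
      qed
      finally show ?thesis .
    qed
    moreover have "2 * (2 * (real D)\<^sup>2 * P * P') / (P + P') = p \<alpha> * (2 * (real D)\<^sup>2 * (A * B / (A + B)))"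
    \<comment> \<open>In the degenerate case both sides are 0, since division by zero yields
      0.\<close>
    proof (cases "p \<alpha> = 0 \<or> A + B = 0")
      case True
      then show ?thesis by (auto simp: P_def P'_def distrib_left[symmetric] add_divide_distrib[symmetric])
    next
      case False
      have "P + P' = p \<alpha> * (A + B) / 2" by (simp add: P_def P'_def distrib_left add_divide_distrib)
      moreover have "2 * (2 * D2 * (q * A / 2) * (q * B / 2)) / (q * s / 2) = q * (2 * D2 * (A * B / s))"
        if "q \<noteq> 0" "s \<noteq> 0" for q s D2 :: real
        using that by (simp add: field_simps)
      ultimately show ?thesis using False by (simp only: P_def P'_def) simp
    qed
    ultimately show ?thesis by simp
  qed
  let ?T = "\<lambda>\<alpha> l. hypergeom (n * card \<alpha>) (n * card ({..<N} - \<alpha>)) K l * hypergeom (n * card \<alpha>) (n * card ({..<N} - \<alpha>)) (K - D) l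
          / (hypergeom (n * card \<alpha>) (n * card ({..<N} - \<alpha>)) K l
             + hypergeom (n * card \<alpha>) (n * card ({..<N} - \<alpha>)) (K - D) l)"
  have "qfi ?H (erase n p (probe_state n N ket M \<theta>)) (erase n p (probe_deriv n N ket M \<theta>))
      = (\<Sum>j\<in>?L. 2 * (\<Sum>\<xi>\<in>?H. \<Sum>\<eta>\<in>?H. (g \<xi> - g \<eta>)\<^sup>2 * (cmod (?v j \<xi>))\<^sup>2 * (cmod (?v j \<eta>))\<^sup>2)
          / (\<Sum>\<xi>\<in>?H. (cmod (?v j \<xi>))\<^sup>2))"
    by (rule qfi(2))
  also have "\<dots> = (\<Sum>(\<alpha>, l)\<in>?L. p \<alpha> * (2 * (real D)\<^sup>2 * ?T \<alpha> l))"
    by (rule sum.cong[OF refl]) (use block in \<open>auto simp del: times_divide_eq_right\<close>)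
  also have "\<dots> = (\<Sum>\<alpha>\<in>erasure_sets N d. \<Sum>l\<le>n * card \<alpha>. p \<alpha> * (2 * (real D)\<^sup>2 * ?T \<alpha> l))"
    by (rule sum.Sigma[symmetric]) (auto simp: finite_erasure_sets)
  finally show "qfi ?H (erase n p (probe_state n N ket M \<theta>)) (erase n p (probe_deriv n N ket M \<theta>))
      = (\<Sum>\<alpha>\<in>erasure_sets N d. p \<alpha> * (2 * (real D)\<^sup>2 * (\<Sum>l\<le>n * card \<alpha>. ?T \<alpha> l)))"
    by (simp only: sum_distrib_left)
qed

section \<open>Scaling\<close>

text \<open>With \<open>D = 2 * M\<close> the prefactor is \<open>8 * M\<^sup>2\<close>, and the
  overlap of every lost set lies between 1/4 and 1/2. The assumption \<open>room\<close> lets the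
  lower level \<open>J - M\<close> supply any possible lost level.\<close>

lemma qfi_erased_probe_bounds:
  fixes \<theta> :: real
  assumes n: "n \<ge> 1" and top: "top_multiplet n N ket"
    and M: "M \<in> mag_numbers (real n / 2 * real N)"
    and gap: "real n * real d + 1 \<le> 2 * M"
    and room: "real n * real d + M \<le> real n / 2 * real N"
    and dM: "16 * real d * M\<^sup>2 \<le> (real N)\<^sup>2"
    and p: "erasure_dist N d p"
  defines "\<rho> \<equiv> erase n p (probe_state n N ket M \<theta>)" and "d\<rho> \<equiv> erase n p (probe_deriv n N ket M \<theta>)"
  shows "\<exists>R. is_SLD (erased_space n N d) \<rho> d\<rho> R"
    and "2 * M\<^sup>2 \<le> qfi (erased_space n N d) \<rho> d\<rho>"
    and "qfi (erased_space n N d) \<rho> d\<rho> \<le> 4 * M\<^sup>2"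
proof -
  obtain K where K: "K \<le> n * N" "M = real K - real n / 2 * real N"
    using mag_numbers_D[OF refl M] by blast
  have "0 \<le> real n * real d" by simp
  then have "0 < M" using gap by linarith
  then have "real (n * N) < real (2 * K)" using K(2) by (simp add: algebra_simps)
  then have lt: "n * N < 2 * K" by (simp only: of_nat_less_iff)
  define D where "D = 2 * K - n * N"
  have D: "2 * K = n * N + D" using lt by (simp add: D_def)
  then have "real (2 * K) = real (n * N + D)" by (rule arg_cong)
  then have DM: "real D = 2 * M" using K(2) by (simp add: algebra_simps)
  have "real (n * d) < real D" using gap DM by simp
  then have nd: "n * d < D" by (simp only: of_nat_less_iff)
  have "real (n * d + K) \<le> real (n * N)"
    using room unfolding K(2) of_nat_add of_nat_mult by linarith
  then have dK: "n * d \<le> n * N - K" unfolding of_nat_le_iff by linarith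
  note exact = qfi_erased_probe[OF top K(1) D nd dK p, folded K(2), of \<theta>]
  show "\<exists>R. is_SLD (erased_space n N d) \<rho> d\<rho> R" unfolding \<rho>_def d\<rho>_def by (rule exact(1))
  define S where "S \<alpha> = (\<Sum>l\<le>n * card \<alpha>.
          hypergeom (n * card \<alpha>) (n * card ({..<N} - \<alpha>)) K l * hypergeom (n * card \<alpha>) (n * card ({..<N} - \<alpha>)) (K - D) l
          / (hypergeom (n * card \<alpha>) (n * card ({..<N} - \<alpha>)) K l
             + hypergeom (n * card \<alpha>) (n * card ({..<N} - \<alpha>)) (K - D) l))" for \<alpha>
  have S: "1 / 4 \<le> S \<alpha>" "S \<alpha> \<le> 1 / 2" if \<alpha>: "\<alpha> \<in> erasure_sets N d" for \<alpha>
  proof -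
    define t where "t = n * card \<alpha>"
    define m where "m = n * card ({..<N} - \<alpha>)"
    have tm: "t + m = n * N"
      unfolding t_def m_def using \<alpha> by (intro lost_plus_surviving_levels) (simp add: erasure_sets_def)
    have td: "t \<le> n * d" using \<alpha> by (simp add: t_def erasure_sets_def)
    have hyp: "2 * K = t + m + D" "t < D" "K \<le> m" using D tm td nd dK lt K(1) by linarith+
    note overlap = hypergeom_overlap[OF hyp, folded S_def[of \<alpha>, folded t_def m_def]]
    show "S \<alpha> \<le> 1 / 2" by (rule overlap(1))
    have N0: "0 < n * N" using lt K(1) by linarith
    \<comment> \<open>The constant 16 in \<open>dM\<close> arises here: a factor 4 from
      \<open>D\<^sup>2 = 4 * M\<^sup>2\<close>, and another 4 to bring the shortfall down to
      1/4.\<close>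
    have "4 * (real t * (real D)\<^sup>2) = 16 * real t * M\<^sup>2" by (simp add: DM)
    also have "\<dots> \<le> 16 * (real n * real d) * M\<^sup>2"
      using td of_nat_mono[OF td, where 'a = real] by (intro mult_right_mono) auto
    also have "\<dots> \<le> real n * (real N)\<^sup>2" using mult_left_mono[OF dM, of "real n"] by (simp add: mult_ac)
    also have "\<dots> \<le> real n * (real n * (real N)\<^sup>2)"
      using n mult_right_mono[of 1 "real n" "(real N)\<^sup>2"] by (intro mult_left_mono) auto
    also have "\<dots> = real (t + m) * real (n * N)" unfolding tm by (simp add: power2_eq_square)
    also have "\<dots> \<le> real (t + m) * (2 * (real m + 1))"
    proof (rule mult_left_mono)
      \<comment> \<open>At most \<open>n * N - K\<close> of the levels are lost, so
        \<open>m \<ge> K\<close>, which exceeds half of \<open>n * N\<close>.\<close>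
      have "n * N \<le> 2 * m" using tm td dK lt K(1) by linarith
      then have "real (n * N) \<le> real (2 * m)" by (simp only: of_nat_le_iff)
      then show "real (n * N) \<le> 2 * (real m + 1)" by simp
    qed simp
    finally have "real t * (real D)\<^sup>2 \<le> 1 / 4 * (2 * real (t + m) * (real m + 1))"
      by (simp add: algebra_simps)
    moreover have "0 < 2 * real (t + m) * (real m + 1)" using N0 unfolding tm by simp
    ultimately have "real t * (real D)\<^sup>2 / (2 * real (t + m) * (real m + 1)) \<le> 1 / 4"
      by (simp only: pos_divide_le_eq)
    then show "1 / 4 \<le> S \<alpha>" using overlap(2) by linarith
  qed
  have p: "\<And>\<alpha>. \<alpha> \<in> erasure_sets N d \<Longrightarrow> 0 \<le> p \<alpha>" "(\<Sum>\<alpha>\<in>erasure_sets N d. p \<alpha>) = 1"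
    using p by (auto simp: erasure_dist_def)
  have qfi: "qfi (erased_space n N d) \<rho> d\<rho> = (\<Sum>\<alpha>\<in>erasure_sets N d. p \<alpha> * (8 * M\<^sup>2 * S \<alpha>))"
    unfolding \<rho>_def d\<rho>_def exact(2) S_def DM by (simp add: power_mult_distrib)
  have const: "(\<Sum>\<alpha>\<in>erasure_sets N d. p \<alpha> * a) = a" for a :: real
    using p(2) by (simp add: sum_distrib_right[symmetric])
  have "(\<Sum>\<alpha>\<in>erasure_sets N d. p \<alpha> * (8 * M\<^sup>2 * (1 / 4))) \<le> qfi (erased_space n N d) \<rho> d\<rho>"
    unfolding qfi using p(1) S by (intro sum_mono mult_left_mono) auto
  then show "2 * M\<^sup>2 \<le> qfi (erased_space n N d) \<rho> d\<rho>" unfolding const by simp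
  have "qfi (erased_space n N d) \<rho> d\<rho> \<le> (\<Sum>\<alpha>\<in>erasure_sets N d. p \<alpha> * (8 * M\<^sup>2 * (1 / 2)))"
    unfolding qfi using p(1) S by (intro sum_mono mult_left_mono) auto
  then show "qfi (erased_space n N d) \<rho> d\<rho> \<le> 4 * M\<^sup>2" unfolding const by simp
qed

section \<open>Comparison of powers of \<open>N\<close> and the asymptotic bounds\<close>

lemma eventually_powr_le:
  fixes a b C :: real
  assumes "a < b"
  shows "\<forall>\<^sub>F N in sequentially. C * real N powr a \<le> real N powr b"
proof -
  have "((\<lambda>N. real N powr (a - b)) \<longlongrightarrow> 0) sequentially"
    using assms by (intro tendsto_neg_powr filterlim_real_sequentially) simp
  then have "((\<lambda>N. C * real N powr (a - b)) \<longlongrightarrow> C * 0) sequentially" by (intro tendsto_intros)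
  then have "\<forall>\<^sub>F N in sequentially. C * real N powr (a - b) < 1"
    by (intro order_tendstoD(2)) auto
  then show ?thesis
  proof eventually_elim
    case (elim N)
    have "C * real N powr a = C * real N powr (a - b) * real N powr b"
      by (simp add: powr_add[symmetric])
    also have "\<dots> \<le> 1 * real N powr b" using elim by (intro mult_right_mono) auto
    finally show ?case by simp
  qed
qed

text \<open>The constants are chosen before \<open>N\<close>, \<open>\<theta>\<close> and
  \<open>p\<close>, which expresses uniformity; a single known lost set is a point distribution
  \<open>p\<close>. Existence of a symmetric logarithmic derivative is part of the claim, so that
  \<open>qfi\<close> is a genuine value.\<close>

theorem mainTheorem5:
  fixes n :: nat and b c :: real
    and M :: "nat \<Rightarrow> real" and d :: "nat \<Rightarrow> nat"
    and ket :: "nat \<Rightarrow> real \<Rightarrow> (nat \<Rightarrow> nat) ket"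
  assumes "n \<ge> 1"
    and "1 / 2 < b" and "b < 1" and "0 \<le> c" and "c \<le> b" and "c < 2 * (1 - b)"
    and "\<forall>\<^sub>F N in sequentially. M N \<in> mag_numbers (real n / 2 * real N) \<and> M N > 0"
    and "M \<in> \<Theta>(\<lambda>N. real N powr b)"
    and "(\<lambda>N. real (d N)) \<in> \<Theta>(\<lambda>N. real N powr c)"
    and "\<forall>\<^sub>F N in sequentially. 2 * M N \<ge> real n * real (d N) + 1"
    and "\<And>N. top_multiplet n N (ket N)"
  shows "(\<exists>c\<^sub>1>0. \<exists>c\<^sub>2>0. \<forall>\<^sub>F N in sequentially. \<forall>\<theta> p. erasure_dist N (d N) p \<longrightarrow>
           (let H = erased_space n N (d N);
                \<rho> = erase n p (probe_state n N (ket N) (M N) \<theta>);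
                d\<rho> = erase n p (probe_deriv n N (ket N) (M N) \<theta>)
            in (\<exists>R. is_SLD H \<rho> d\<rho> R) \<and>
               c\<^sub>1 * real N powr (2 * b) \<le> qfi H \<rho> d\<rho> \<and>
               qfi H \<rho> d\<rho> \<le> c\<^sub>2 * real N powr (2 * b)))
       \<and> (\<forall>K. \<forall>\<^sub>F N in sequentially. \<forall>\<theta> p. erasure_dist N (d N) p \<longrightarrow>
           K * real N \<le> qfi (erased_space n N (d N))
             (erase n p (probe_state n N (ket N) (M N) \<theta>))
             (erase n p (probe_deriv n N (ket N) (M N) \<theta>)))"
proof -
  obtain m\<^sub>1 where m1: "m\<^sub>1 > 0" "\<forall>\<^sub>F N in sequentially. m\<^sub>1 * real N powr b \<le> \<bar>M N\<bar>"
    using landau_omega.bigE[OF bigthetaD2[OF assms(8)]] by auto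
  obtain m\<^sub>2 where m2: "m\<^sub>2 > 0" "\<forall>\<^sub>F N in sequentially. \<bar>M N\<bar> \<le> m\<^sub>2 * real N powr b"
    using landau_o.bigE[OF bigthetaD1[OF assms(8)]] by auto
  obtain k where k: "k > 0" "\<forall>\<^sub>F N in sequentially. real (d N) \<le> k * real N powr c"
    using landau_o.bigE[OF bigthetaD1[OF assms(9)]] by auto
  have cb: "c + 2 * b < 2" using assms(6) by simp
  \<comment> \<open>The two power comparisons supply the size conditions: \<open>b < 1\<close> and
    \<open>c \<le> b\<close> make \<open>n * d + M\<close> at most \<open>n * N / 2\<close>, and
    \<open>c + 2 * b < 2\<close> makes \<open>16 * d * M\<^sup>2\<close> at most
    \<open>N\<^sup>2\<close>.\<close>
  have main: "\<forall>\<^sub>F N in sequentially. \<forall>\<theta> p. erasure_dist N (d N) p \<longrightarrow>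
           (\<exists>R. is_SLD (erased_space n N (d N)) (erase n p (probe_state n N (ket N) (M N) \<theta>))
              (erase n p (probe_deriv n N (ket N) (M N) \<theta>)) R) \<and>
           2 * m\<^sub>1\<^sup>2 * real N powr (2 * b) \<le> qfi (erased_space n N (d N)) (erase n p (probe_state n N (ket N) (M N) \<theta>))
              (erase n p (probe_deriv n N (ket N) (M N) \<theta>)) \<and>
           qfi (erased_space n N (d N)) (erase n p (probe_state n N (ket N) (M N) \<theta>))
              (erase n p (probe_deriv n N (ket N) (M N) \<theta>)) \<le> 4 * m\<^sub>2\<^sup>2 * real N powr (2 * b)"
    using assms(7,10) m1(2) m2(2) k(2) eventually_gt_at_top[of 0]
      eventually_powr_le[OF assms(3), of "2 * (real n * k + m\<^sub>2)"]
      eventually_powr_le[of "c + 2 * b" 2 "16 * k * m\<^sub>2\<^sup>2", OF cb]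
  proof eventually_elim
    case (elim N)
    let ?X = "real N powr b"
    have sq: "?X\<^sup>2 = real N powr (2 * b)" by (simp add: power2_eq_square powr_add[symmetric])
    have X0: "0 \<le> ?X" by simp
    have M: "0 < M N" "m\<^sub>1 * ?X \<le> M N" "M N \<le> m\<^sub>2 * ?X" using elim(1,3,4) by auto
    have lo: "m\<^sub>1\<^sup>2 * real N powr (2 * b) \<le> (M N)\<^sup>2"
      unfolding sq[symmetric] power_mult_distrib[symmetric] using M m1(1) by (intro power_mono) auto
    have hi: "(M N)\<^sup>2 \<le> m\<^sub>2\<^sup>2 * real N powr (2 * b)"
      unfolding sq[symmetric] power_mult_distrib[symmetric] using M by (intro power_mono) auto
    have "real (d N) \<le> k * real N powr c" by (rule elim(5))
    also have "\<dots> \<le> k * ?X" using elim(6) k(1) assms(5) by (intro mult_left_mono powr_mono) auto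
    finally have "real n * real (d N) \<le> real n * (k * ?X)" by (rule mult_left_mono) simp
    then have "2 * (real n * real (d N) + M N) \<le> 2 * (real n * k + m\<^sub>2) * ?X"
      using M(3) by (simp add: algebra_simps)
    also have "\<dots> \<le> real N" using elim(6,7) by simp
    also have "\<dots> \<le> real n * real N" using assms(1) mult_right_mono[of 1 "real n" "real N"] by simp
    finally have room: "real n * real (d N) + M N \<le> real n / 2 * real N" by simp
    have "16 * real (d N) * (M N)\<^sup>2 \<le> 16 * (k * real N powr c) * (m\<^sub>2\<^sup>2 * real N powr (2 * b))"
      using elim(5) hi k(1) by (intro mult_mono) auto
    also have "\<dots> = 16 * k * m\<^sub>2\<^sup>2 * real N powr (c + 2 * b)" by (simp add: powr_add)
    also have "\<dots> \<le> (real N)\<^sup>2" using elim(6,8) by (simp add: powr_numeral)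
    finally have dM: "16 * real (d N) * (M N)\<^sup>2 \<le> (real N)\<^sup>2" .
    have mag: "M N \<in> mag_numbers (real n / 2 * real N)" using elim(1) by blast
    show ?case
    proof (intro allI impI)
      fix \<theta> p assume "erasure_dist N (d N) p"
      note bounds = qfi_erased_probe_bounds[OF assms(1,11) mag elim(2) room dM this, of \<theta>]
      show "(\<exists>R. is_SLD (erased_space n N (d N)) (erase n p (probe_state n N (ket N) (M N) \<theta>))
              (erase n p (probe_deriv n N (ket N) (M N) \<theta>)) R) \<and>
           2 * m\<^sub>1\<^sup>2 * real N powr (2 * b) \<le> qfi (erased_space n N (d N)) (erase n p (probe_state n N (ket N) (M N) \<theta>))
              (erase n p (probe_deriv n N (ket N) (M N) \<theta>)) \<and>
           qfi (erased_space n N (d N)) (erase n p (probe_state n N (ket N) (M N) \<theta>))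
              (erase n p (probe_deriv n N (ket N) (M N) \<theta>)) \<le> 4 * m\<^sub>2\<^sup>2 * real N powr (2 * b)"
        using bounds lo hi by auto
    qed
  qed
  have superlinear: "\<forall>\<^sub>F N in sequentially. \<forall>\<theta> p. erasure_dist N (d N) p \<longrightarrow>
           K * real N \<le> qfi (erased_space n N (d N))
             (erase n p (probe_state n N (ket N) (M N) \<theta>))
             (erase n p (probe_deriv n N (ket N) (M N) \<theta>))" for K
  proof -
    have "1 < 2 * b" using assms(2) by simp
    from main eventually_powr_le[OF this, of "K / (2 * m\<^sub>1\<^sup>2)"] show ?thesis
    proof eventually_elim
      case (elim N)
      have "K * real N \<le> 2 * m\<^sub>1\<^sup>2 * real N powr (2 * b)"
        using elim(2) m1(1) by (simp add: field_simps)
      then show ?case using elim(1) by (meson order_trans)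
    qed
  qed
  have "2 * m\<^sub>1\<^sup>2 > 0" "4 * m\<^sub>2\<^sup>2 > 0" using m1(1) m2(1) by auto
  with main superlinear show ?thesis unfolding Let_def by blast
qed

end
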